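(* For all $\varepsilon>0$, there exist $\sigma,\delta\ge 1$ such that there is no algorithm that solves every $n$-vertex instance of Triangle Partition given with a $(\sigma,\delta)$-hub of size at most $p$ in time $(2-\varepsilon)^{p}\cdot n^{\mathcal{O}(1)}$, unless the SCC fails.
   Context: For a graph $G$, a set $Q\subseteq V(G)$ is a $(\sigma,\delta)$-hub if every connected component of $G-Q$ has at most $\sigma$ vertices and is adjacent to at most $\delta$ vertices of $Q$. Triangle Partition: given a graph $G$, decide whether $V(G)$ can be partitioned into vertex sets of triangles of $G$. $\le d$-Set Cover: given a universe $U$, a family $\mathcal{F}$ of subsets of $U$ of size at most $d$ with $\bigcup\mathcal{F}=U$, and an integer $t$, decide whether at most $t$ sets of $\mathcal{F}$ cover $U$. SCC: for all $\epsilon>0$ there is $d\ge1$ such that no algorithm solves every $\le d$-Set Cover instance in time $(2-\epsilon)^{|U|}|U|^{\mathcal{O}(1)}$. *)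

theory Defs
  imports Complex_Main "HOL-Library.Discrete_Functions" "HOL-Library.Disjoint_Sets"
begin

section \<open>Algorithms and their running time\<close>

text \<open>
  An algorithm is a while program operating on arrays of natural numbers, with logarithmic costs.
  A program mentions only finitely many arrays; interleaving them in one memory turns it into a
  random access machine program, and conversely, with constant-factor overhead in the logarithmic
  cost. Logarithmic instead of unit costs rule out that long numbers provide free parallelism.
\<close>

type_synonym mem = "nat \<Rightarrow> nat \<Rightarrow> nat"

datatype binop = Plus | Minus | Times | Div

datatype aexp =
    Const nat
  | Read nat aexp
  | Binop binop aexp aexp

datatype com =
    Skip
  | Write nat aexp aexp
  | Seq com com
  | Cond aexp com com
  | While aexp com

fun apply_op :: "binop \<Rightarrow> nat \<Rightarrow> nat \<Rightarrow> nat" where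
  "apply_op Plus x y = x + y"
| "apply_op Minus x y = x - y"
| "apply_op Times x y = x * y"
| "apply_op Div x y = x div y"

fun val :: "aexp \<Rightarrow> mem \<Rightarrow> nat" where
  "val (Const x) s = x"
| "val (Read a e) s = s a (val e s)"
| "val (Binop f e1 e2) s = apply_op f (val e1 s) (val e2 s)"

text \<open>The number of binary digits, with one digit for zero (\<^term>\<open>floor_log 0 = 0\<close>).\<close>

definition len :: "nat \<Rightarrow> nat" where
  "len x = floor_log x + 1"

fun cost :: "aexp \<Rightarrow> mem \<Rightarrow> nat" where
  "cost (Const x) s = len x"
| "cost (Read a e) s = cost e s + len (val e s) + len (s a (val e s))"
| "cost (Binop f e1 e2) s = cost e1 s + cost e2 s + len (val e1 s) + len (val e2 s)"

text \<open>\<open>exec c s t s'\<close>: started in memory \<open>s\<close>, program \<open>c\<close> halts in memory \<open>s'\<close> after time \<open>t\<close>.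
  A condition holds iff its value is nonzero.\<close>

inductive exec :: "com \<Rightarrow> mem \<Rightarrow> nat \<Rightarrow> mem \<Rightarrow> bool" where
  Skip: "exec Skip s 1 s"
| Write: "exec (Write a e1 e2) s (cost e1 s + cost e2 s + len (val e1 s) + len (val e2 s))
            (s(a := (s a)(val e1 s := val e2 s)))"
| Seq: "exec c1 s t1 s1 \<Longrightarrow> exec c2 s1 t2 s2 \<Longrightarrow> exec (Seq c1 c2) s (t1 + t2) s2"
| CondTrue: "val e s \<noteq> 0 \<Longrightarrow> exec c1 s t s1 \<Longrightarrow>
    exec (Cond e c1 c2) s (cost e s + len (val e s) + t) s1"
| CondFalse: "val e s = 0 \<Longrightarrow> exec c2 s t s2 \<Longrightarrow>
    exec (Cond e c1 c2) s (cost e s + len (val e s) + t) s2"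
| WhileFalse: "val e s = 0 \<Longrightarrow> exec (While e c) s (cost e s + len (val e s)) s"
| WhileTrue: "val e s \<noteq> 0 \<Longrightarrow> exec c s t1 s1 \<Longrightarrow> exec (While e c) s1 t2 s2 \<Longrightarrow>
    exec (While e c) s (cost e s + len (val e s) + t1 + t2) s2"

inductive_cases SkipE: "exec Skip s t s'"
inductive_cases WriteE: "exec (Write a e1 e2) s t s'"
inductive_cases SeqE: "exec (Seq c1 c2) s t s'"
inductive_cases CondE: "exec (Cond e c1 c2) s t s'"
inductive_cases WhileE: "exec (While e c) s t s'"

lemma exec_deterministic:
  "exec c s t s1 \<Longrightarrow> exec c s t' s1' \<Longrightarrow> t' = t \<and> s1' = s1"
proof (induction arbitrary: t' s1' rule: exec.induct)
  case Skip
  then show ?case by (elim SkipE) simp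
next
  case Write
  then show ?case by (elim WriteE) simp
next
  case (Seq c1 s t1 s1 c2 t2 s2)
  from Seq.prems show ?case by (elim SeqE) (use Seq.IH in blast)
next
  case (CondTrue e s c1 t s1 c2)
  from CondTrue.prems show ?case by (elim CondE) (use CondTrue.IH CondTrue.hyps in blast)+
next
  case (CondFalse e s c2 t s2 c1)
  from CondFalse.prems show ?case by (elim CondE) (auto simp: CondFalse.hyps dest!: CondFalse.IH)
next
  case (WhileFalse e s c)
  from WhileFalse.prems show ?case by (rule WhileE) (simp_all add: WhileFalse.hyps)
next
  case (WhileTrue e s c t1 s1 t2 s2)
  from WhileTrue.prems show ?case
    by (rule WhileE) (auto simp: WhileTrue.hyps dest!: WhileTrue.IH)
qed

definition input_mem :: "nat list \<Rightarrow> mem" where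
  "input_mem xs = (\<lambda>a i. if a = 0 \<and> i < length xs then xs ! i else 0)"

definition decides_within :: "com \<Rightarrow> nat list \<Rightarrow> bool \<Rightarrow> real \<Rightarrow> bool" where
  "decides_within c xs b T \<longleftrightarrow>
     (\<exists>t s. exec c (input_mem xs) t s \<and> s 0 0 = of_bool b \<and> real t \<le> T)"

section \<open>Graphs, hubs and Triangle Partition\<close>

definition simple_graph :: "'a set \<Rightarrow> ('a \<times> 'a) set \<Rightarrow> bool" where
  "simple_graph V E \<longleftrightarrow> finite V \<and> E \<subseteq> V \<times> V \<and> sym E \<and> irrefl E"

text \<open>The connected components of the subgraph induced by \<open>W\<close>.\<close>

definition components_on :: "('a \<times> 'a) set \<Rightarrow> 'a set \<Rightarrow> 'a set set" where
  "components_on E W = (\<lambda>v. {u. (v, u) \<in> (E \<inter> W \<times> W)\<^sup>*}) ` W"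

definition is_hub :: "nat \<Rightarrow> nat \<Rightarrow> 'a set \<Rightarrow> ('a \<times> 'a) set \<Rightarrow> 'a set \<Rightarrow> bool" where
  "is_hub \<sigma> \<delta> V E Q \<longleftrightarrow> Q \<subseteq> V \<and>
     (\<forall>C\<in>components_on E (V - Q).
        card C \<le> \<sigma> \<and> card {q \<in> Q. \<exists>v\<in>C. (v, q) \<in> E} \<le> \<delta>)"

definition is_triangle :: "('a \<times> 'a) set \<Rightarrow> 'a set \<Rightarrow> bool" where
  "is_triangle E T \<longleftrightarrow>
     (\<exists>a b c. T = {a, b, c} \<and> (a, b) \<in> E \<and> (b, c) \<in> E \<and> (a, c) \<in> E)"

definition triangle_partition :: "'a set \<Rightarrow> ('a \<times> 'a) set \<Rightarrow> bool" where
  "triangle_partition V E \<longleftrightarrow> (\<exists>P. partition_on V P \<and> (\<forall>T\<in>P. is_triangle E T))"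

text \<open>The vertices are \<open>0, \<dots>, n - 1\<close>; the graph is given by its adjacency matrix.\<close>

definition encode_graph_hub :: "nat \<Rightarrow> (nat \<times> nat) set \<Rightarrow> nat set \<Rightarrow> nat list" where
  "encode_graph_hub n E Q =
     n # concat (map (\<lambda>u. map (\<lambda>v. of_bool ((u, v) \<in> E)) [0..<n]) [0..<n])
       @ map (\<lambda>v. of_bool (v \<in> Q)) [0..<n]"

text \<open>A function is in \<open>n\<^bsup>O(1)\<^esup>\<close> iff it is at most \<open>k * n ^ k + k\<close> for some constant \<open>k\<close>;
  the additive term leaves room for constant time when \<open>n \<le> 1\<close>.\<close>

definition solves_triangle_partition_hub :: "com \<Rightarrow> nat \<Rightarrow> nat \<Rightarrow> real \<Rightarrow> bool" where
  "solves_triangle_partition_hub c \<sigma> \<delta> b \<longleftrightarrow>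
     (\<exists>k::nat. \<forall>n p E Q. simple_graph {..<n} E \<longrightarrow> is_hub \<sigma> \<delta> {..<n} E Q \<longrightarrow> card Q \<le> p \<longrightarrow>
        decides_within c (encode_graph_hub n E Q) (triangle_partition {..<n} E)
          (b ^ p * real (k * n ^ k + k)))"

section \<open>Set Cover and the Set Cover Conjecture\<close>

definition set_cover_instance :: "nat \<Rightarrow> 'a set \<Rightarrow> 'a set set \<Rightarrow> bool" where
  "set_cover_instance d U F \<longleftrightarrow>
     finite U \<and> (\<forall>S\<in>F. S \<subseteq> U \<and> card S \<le> d) \<and> \<Union> F = U"

definition set_cover :: "'a set \<Rightarrow> 'a set set \<Rightarrow> nat \<Rightarrow> bool" where
  "set_cover U F t \<longleftrightarrow> (\<exists>C\<subseteq>F. card C \<le> t \<and> \<Union> C = U)"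

definition lists_family :: "'a list list \<Rightarrow> 'a set set \<Rightarrow> bool" where
  "lists_family Fs F \<longleftrightarrow>
     (\<forall>S\<in>set Fs. distinct S) \<and> distinct (map set Fs) \<and> set ` set Fs = F"

text \<open>
  The universe is \<open>{0, \<dots>, n - 1}\<close>. The number \<open>t\<close> is not bounded in terms of \<open>n\<close>, so that a time
  bound depending on \<open>n\<close> only would not permit to read it from a single cell. It is therefore
  given in unary at the end of the input, followed by zeros; instances with \<open>t \<ge> n\<close> are
  yes-instances and can be recognized without reading all of \<open>t\<close>.
\<close>

definition encode_set_cover :: "nat \<Rightarrow> nat list list \<Rightarrow> nat \<Rightarrow> nat list" where
  "encode_set_cover n Fs t =
     n # length Fs # concat (map (\<lambda>S. length S # S) Fs) @ replicate t 1"

definition solves_set_cover :: "com \<Rightarrow> nat \<Rightarrow> real \<Rightarrow> bool" where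
  "solves_set_cover c d b \<longleftrightarrow>
     (\<exists>k::nat. \<forall>n F Fs t. set_cover_instance d {..<n} F \<longrightarrow> lists_family Fs F \<longrightarrow>
        decides_within c (encode_set_cover n Fs t) (set_cover {..<n} F t)
          (b ^ n * real (k * n ^ k + k)))"

definition SCC :: bool where
  "SCC \<longleftrightarrow> (\<forall>\<epsilon>::real. \<epsilon> > 0 \<longrightarrow> (\<exists>d\<ge>1. \<not> (\<exists>c. solves_set_cover c d (2 - \<epsilon>))))"

end

theory Submission
  imports Defs
begin

text \<open>
  Fix a constant \<open>q\<close>. A cover by at most \<open>t\<close> sets is split into about \<open>n / q\<close> groups of at most \<open>q\<close>
  sets. The hub consists of the \<open>n\<close> elements, one token per group, and about two padding vertices per
  group, which form a clique; so its size is about \<open>(1 + 3 / q) n\<close>. For every token and every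
  \<open>q\<close>-tuple of sets there is a gadget of constant size which either is partitioned on its own, or
  absorbs its token and any subset of the elements and padding vertices attached to it such that the
  number of absorbed vertices is divisible by 3. As every token is absorbed exactly once, the gadgets
  in use choose at most \<open>t\<close> sets. An algorithm with running time \<open>b\<^bsup>p\<^esup>\<close> for Triangle Partition,
  where \<open>b < 2\<close>, thus yields one with running time \<open>(b\<^bsup>1 + 3 / q\<^esup>)\<^bsup>n\<^esup>\<close> for Set Cover, and
  the base is less than 2 for large \<open>q\<close>.
\<close>

section \<open>Triangle partitions\<close>

text \<open>The size of the hub is the obstacle: with one token per chosen set it could reach
  \<open>2 * n\<close>, which squares the base. One token per \<open>q\<close> sets is cheap; the
  price is a gadget for every \<open>q\<close>-tuple, and their number stays polynomial because
  \<open>q\<close> and \<open>d\<close> are constants. Padding is forced by counting: a gadget has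
  \<open>12 * h\<close> vertices, so the hub vertices absorbed with it must number a multiple of 3,
  and two padding vertices correct any residue. Absorbing arbitrary subsets matters because chosen
  sets overlap while each element can be absorbed only once. The \<open>3 / q\<close> counts one
  token and two padding vertices for each of \<open>n div q + 1\<close> groups. The size of the
  graph does not depend on \<open>t\<close>, which only decides which slots of the groups are open.
  The constants are fixed in the order \<open>q\<close> from \<epsilon>, \<open>d\<close> from the
  SCC for the resulting base, then \<sigma> and \<delta> from \<open>d\<close> and
  \<open>q\<close>.\<close>

lemma triangle_partition_empty: "triangle_partition {} E"
  unfolding triangle_partition_def by (intro exI[of _ "{}"]) (simp add: partition_on_def)

lemma triangle_partition_Un:
  assumes "triangle_partition A E" "triangle_partition B E" "A \<inter> B = {}"
  shows "triangle_partition (A \<union> B) E"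
proof -
  obtain P Q where "partition_on A P" "\<forall>T\<in>P. is_triangle E T"
    "partition_on B Q" "\<forall>T\<in>Q. is_triangle E T"
    using assms(1,2) unfolding triangle_partition_def by blast
  then show ?thesis
    unfolding triangle_partition_def using assms(3)
    by (intro exI[of _ "P \<union> Q"]) (auto simp: partition_on_def intro: disjoint_union)
qed

lemma triangle_partition_UN:
  assumes "finite I" "\<And>i. i \<in> I \<Longrightarrow> triangle_partition (A i) E" "disjoint_family_on A I"
  shows "triangle_partition (\<Union>i\<in>I. A i) E"
  using assms
proof (induction I)
  case empty
  then show ?case by (simp add: triangle_partition_empty)
next
  case (insert x I)
  have "A x \<inter> (\<Union>i\<in>I. A i) = {}"
    using insert.prems(2) insert.hyps(2) by (auto simp: disjoint_family_on_def)
  moreover have "disjoint_family_on A I"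
    using insert.prems(2) by (auto simp: disjoint_family_on_def)
  ultimately show ?case
    using insert by (simp add: triangle_partition_Un)
qed

lemma triangle_partition_triangle:
  assumes "(a, b) \<in> E" "(b, c) \<in> E" "(a, c) \<in> E"
  shows "triangle_partition {a, b, c} E"
  unfolding triangle_partition_def is_triangle_def
  using assms by (intro exI[of _ "{{a, b, c}}"]) (auto simp: partition_on_def disjoint_def)

lemma triangle_partition_clique:
  assumes "finite K" "3 dvd card K"
    and "\<And>u v. u \<in> K \<Longrightarrow> v \<in> K \<Longrightarrow> u \<noteq> v \<Longrightarrow> (u, v) \<in> E"
  shows "triangle_partition K E"
proof -
  obtain m where "card K = 3 * m" using assms(2) by auto
  with assms(1,3) show ?thesis
  proof (induction m arbitrary: K)
    case 0
    then show ?case by (simp add: triangle_partition_empty)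
  next
    case (Suc m)
    have "3 \<le> card K" using Suc.prems by simp
    then obtain T where T: "T \<subseteq> K" "card T = 3"
      using obtain_subset_with_card_n by metis
    then obtain a b c where abc: "T = {a, b, c}" "a \<noteq> b" "b \<noteq> c" "a \<noteq> c"
      by (auto simp: card_3_iff)
    have "triangle_partition T E"
      unfolding abc(1) using T(1) abc by (intro triangle_partition_triangle Suc.prems) auto
    moreover have "triangle_partition (K - T) E"
    proof (rule Suc.IH)
      show "card (K - T) = 3 * m"
        using T Suc.prems finite_subset[OF T(1)] by (simp add: card_Diff_subset)
    qed (use Suc.prems in auto)
    ultimately have "triangle_partition (T \<union> (K - T)) E"
      by (rule triangle_partition_Un) auto
    then show ?case using T(1) by (simp add: Un_absorb1)
  qed
qed

lemma UN_UN_Un_disjoint: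
  "(\<And>x. x \<in> I \<Longrightarrow> A x \<inter> Y = {}) \<Longrightarrow> (\<And>k. k \<in> J \<Longrightarrow> B k \<inter> Y = {}) \<Longrightarrow> D \<inter> Y = {} \<Longrightarrow>
    ((\<Union>x\<in>I. A x) \<union> (\<Union>k\<in>J. B k) \<union> D) \<inter> Y = {}"
  by blast

lemma UN_UN_Un_Un_subset:
  "(\<And>x. x \<in> I \<Longrightarrow> A x \<subseteq> Y) \<Longrightarrow> (\<And>k. k \<in> J \<Longrightarrow> B k \<subseteq> Y) \<Longrightarrow> C \<subseteq> Y \<Longrightarrow> D \<subseteq> Y \<Longrightarrow>
    (\<Union>x\<in>I. A x) \<union> (\<Union>k\<in>J. B k) \<union> C \<union> D \<subseteq> Y"
  by blast

text \<open>Ends of port edges have residue 0 or 1 modulo 6, so two consecutive ones belong to the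
  same port.\<close>

lemma consecutive_div6:
  fixes l l' :: nat
  assumes "l mod 6 \<le> 1" "l' mod 6 \<le> 1" "l' = l + 1"
  shows "l' div 6 = l div 6"
  using assms by presburger

text \<open>The last cycle vertex \<open>6 * h - 1\<close> has residue 5, so the edge that closes
  the cycle joins no two port vertices. Truncated subtraction makes \<open>k = 0\<close> the
  exception.\<close>

lemma wrap_mod6:
  fixes k :: nat
  assumes "(6 * k - 1) mod 6 \<le> 1"
  shows "k = 0"
proof (cases k)
  case (Suc j)
  then have "6 * k - 1 = 5 + 6 * j" by simp
  then show ?thesis using assms by (simp only: mod_mult_self2) simp
qed

section \<open>Gadgets\<close>

text \<open>
  The vertices below \<open>6 * h\<close> form a cycle, which has only two perfect matchings. The even edge number
  \<open>k\<close>, \<open>{2 * k, 2 * k + 1}\<close>, can be completed to a triangle by the dummy \<open>6 * h + k\<close>, unless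
  \<open>k = 0\<close>, the odd edge number \<open>k\<close> by the dummy \<open>9 * h + k\<close>; both kinds of dummies form cliques that
  absorb the unused ones. Hub vertices are attached to the even edges number \<open>3 * i\<close>, the token to
  number 0, so that a gadget matched along its even edges has to use its token. Using only every
  third even edge keeps a hub vertex that is attached twice from completing an odd edge.
\<close>

definition gadget_arc :: "nat \<Rightarrow> nat \<Rightarrow> nat \<Rightarrow> bool" where
  "gadget_arc h l l' \<longleftrightarrow>
     l' = l + 1 \<and> l' < 6 * h \<or> l = 6 * h - 1 \<and> l' = 0 \<or>
     2 \<le> l \<and> l < 6 * h \<and> l' = 6 * h + l div 2 \<or>
     l < 6 * h \<and> l' = 9 * h + (if l = 0 then 3 * h - 1 else (l - 1) div 2) \<or>
     6 * h \<le> l \<and> l < l' \<and> l' < 9 * h \<or>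
     9 * h \<le> l \<and> l < l' \<and> l' < 12 * h"

definition gadget_adj :: "nat \<Rightarrow> nat \<Rightarrow> nat \<Rightarrow> bool" where
  "gadget_adj h l l' \<longleftrightarrow> gadget_arc h l l' \<or> gadget_arc h l' l"

definition touches :: "nat \<Rightarrow> (nat \<Rightarrow> nat \<Rightarrow> nat \<Rightarrow> bool) \<Rightarrow> nat \<Rightarrow> nat \<Rightarrow> nat \<Rightarrow> bool" where
  "touches h att g l x \<longleftrightarrow> (\<exists>i<h. att g i x \<and> (l = 6 * i \<or> l = 6 * i + 1))"

text \<open>Adjacency is pure arithmetic on vertex numbers, so that a program can evaluate it entry
  by entry: from \<open>H\<close> on, quotient and remainder by \<open>12 * h\<close> give the
  gadget and the vertex within it. The padding clique begins at \<open>C\<close>.\<close>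

definition hub_adj :: "nat \<Rightarrow> nat \<Rightarrow> nat \<Rightarrow> (nat \<Rightarrow> nat \<Rightarrow> nat \<Rightarrow> bool) \<Rightarrow> nat \<Rightarrow> nat \<Rightarrow> bool" where
  "hub_adj h C H att u v \<longleftrightarrow>
     (if u < H then
        if v < H then C \<le> u \<and> C \<le> v \<and> u \<noteq> v
        else touches h att ((v - H) div (12 * h)) ((v - H) mod (12 * h)) u
      else if v < H then touches h att ((u - H) div (12 * h)) ((u - H) mod (12 * h)) v
      else (u - H) div (12 * h) = (v - H) div (12 * h) \<and>
        gadget_adj h ((u - H) mod (12 * h)) ((v - H) mod (12 * h)))"

text \<open>Vertices below \<open>n\<close> are elements, the next \<open>a\<close> are tokens, the next \<open>y\<close> are padding vertices;
  \<open>att g i x\<close> means that hub vertex \<open>x\<close> is attached to port \<open>i\<close> of gadget \<open>g\<close>.\<close>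

locale hub_graph =
  fixes n a y h G :: nat and tok :: "nat \<Rightarrow> nat" and att :: "nat \<Rightarrow> nat \<Rightarrow> nat \<Rightarrow> bool"
  assumes h_pos: "3 \<le> h"
    and att_less: "att g i x \<Longrightarrow> x < n + a + y"
    and att_unique: "att g i x \<Longrightarrow> att g i x' \<Longrightarrow> x = x'"
    and att_token: "att g 0 x \<longleftrightarrow> x = n + tok g"
    and tok_less: "tok g < a"
begin

section \<open>The graph, its vertex numbering and its hub\<close>

definition "H = n + a + y"
definition "N = H + G * (12 * h)"
definition "E = {(u, v). u < N \<and> v < N \<and> hub_adj h (n + a) H att u v}"
definition gv :: "nat \<Rightarrow> nat \<Rightarrow> nat" where "gv g l = H + (g * (12 * h) + l)"

lemma gv_simps [simp]:
  assumes "l < 12 * h"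
  shows "(gv g l - H) div (12 * h) = g" "(gv g l - H) mod (12 * h) = l"
    "\<not> gv g l < H" "H \<le> gv g l" "gv g l < N \<longleftrightarrow> g < G"
proof -
  show "(gv g l - H) div (12 * h) = g" "(gv g l - H) mod (12 * h) = l"
    using assms by (auto simp: gv_def)
  show "gv g l < N \<longleftrightarrow> g < G"
  proof
    assume "g < G"
    then have "Suc g * (12 * h) \<le> G * (12 * h)" by (intro mult_right_mono) auto
    then show "gv g l < N" using assms by (simp add: gv_def N_def)
  next
    assume "gv g l < N"
    then have "g * (12 * h) < G * (12 * h)" unfolding gv_def N_def by linarith
    then show "g < G" by (metis mult_less_cancel2)
  qed
qed (auto simp: gv_def)

lemma gv_inject:
  "l < 12 * h \<Longrightarrow> l' < 12 * h \<Longrightarrow> gv g l = gv g' l' \<longleftrightarrow> g = g' \<and> l = l'"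
  by (metis gv_simps(1,2))

lemma gv_ne_hub: "x < H \<Longrightarrow> gv g l \<noteq> x" "x < H \<Longrightarrow> x \<noteq> gv g l"
  by (auto simp: gv_def)

lemma gv_cases:
  assumes "v < N"
  obtains "v < H" | g l where "g < G" "l < 12 * h" "v = gv g l"
proof (cases "v < H")
  case False
  have "(v - H) mod (12 * h) < 12 * h" using h_pos by simp
  moreover have "v = gv ((v - H) div (12 * h)) ((v - H) mod (12 * h))"
    using False unfolding gv_def div_mult_mod_eq by simp
  ultimately show ?thesis using that(2) assms gv_simps(5) by metis
qed (use that in auto)

lemma H_le_N: "H \<le> N" by (simp add: N_def)

lemma edge_hub: "u < H \<Longrightarrow> v < H \<Longrightarrow> (u, v) \<in> E \<longleftrightarrow> n + a \<le> u \<and> n + a \<le> v \<and> u \<noteq> v"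
  using H_le_N by (auto simp: E_def hub_adj_def)

lemma edge_hub_gadget:
  "u < H \<Longrightarrow> l < 12 * h \<Longrightarrow> (u, gv g l) \<in> E \<longleftrightarrow> g < G \<and> touches h att g l u"
  using H_le_N by (auto simp: E_def hub_adj_def)

lemma edge_gadget_hub:
  "u < H \<Longrightarrow> l < 12 * h \<Longrightarrow> (gv g l, u) \<in> E \<longleftrightarrow> g < G \<and> touches h att g l u"
  using H_le_N by (auto simp: E_def hub_adj_def)

lemma edge_gadget:
  "l < 12 * h \<Longrightarrow> l' < 12 * h \<Longrightarrow> (gv g l, gv g' l') \<in> E \<longleftrightarrow> g < G \<and> g = g' \<and> gadget_adj h l l'"
  by (auto simp: E_def hub_adj_def)

lemma gadget_adj_sym: "gadget_adj h l l' \<longleftrightarrow> gadget_adj h l' l"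
  by (auto simp: gadget_adj_def)

lemma gadget_adj_irrefl: "\<not> gadget_adj h l l"
  using h_pos by (auto simp: gadget_adj_def gadget_arc_def)

lemma E_sym: "(u, v) \<in> E \<Longrightarrow> (v, u) \<in> E"
  by (auto simp: E_def hub_adj_def gadget_adj_sym split: if_splits)

lemma simple_graph_E: "simple_graph {..<N} E"
  unfolding simple_graph_def
proof (intro conjI)
  show "sym E" using E_sym by (auto intro: symI)
  show "irrefl E" by (auto simp: irrefl_def E_def hub_adj_def gadget_adj_irrefl)
qed (auto simp: E_def)

text \<open>No edge joins two gadgets, so without the hub a component stays within the
  \<open>12 * h\<close> vertices of one gadget. It sees at most one hub vertex through each of its
  \<open>h\<close> ports by \<open>att_unique\<close>.\<close>

lemma is_hub_E: "is_hub (12 * h) h {..<N} E {..<H}"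
  unfolding is_hub_def
proof (intro conjI ballI)
  show "{..<H} \<subseteq> {..<N}" using H_le_N by auto
next
  fix C assume "C \<in> components_on E ({..<N} - {..<H})"
  then obtain v where v: "v \<in> {..<N} - {..<H}"
    and C: "C = {u. (v, u) \<in> (E \<inter> ({..<N} - {..<H}) \<times> ({..<N} - {..<H}))\<^sup>*}"
    unfolding components_on_def by auto
  obtain g l where gl: "g < G" "l < 12 * h" "v = gv g l"
    using v by (auto elim: gv_cases)
  have sub: "C \<subseteq> gv g ` {..<12 * h}"
  proof
    fix u assume "u \<in> C"
    then have "(v, u) \<in> (E \<inter> ({..<N} - {..<H}) \<times> ({..<N} - {..<H}))\<^sup>*" using C by simp
    then show "u \<in> gv g ` {..<12 * h}"
    proof (induction rule: rtrancl_induct)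
      case base
      then show ?case using gl by auto
    next
      case (step u w)
      then obtain l' where l': "l' < 12 * h" "u = gv g l'" by auto
      from step.hyps have "w < N" "\<not> w < H" by auto
      then obtain g' l'' where "g' < G" "l'' < 12 * h" "w = gv g' l''"
        by (auto elim: gv_cases)
      then show ?case using step.hyps l' edge_gadget by auto
    qed
  qed
  then have "card C \<le> card (gv g ` {..<12 * h})" by (intro card_mono) auto
  also have "\<dots> \<le> 12 * h" using card_image_le[of "{..<12 * h}" "gv g"] by simp
  finally show "card C \<le> 12 * h" .
  have "{q \<in> {..<H}. \<exists>v\<in>C. (v, q) \<in> E} \<subseteq> (\<lambda>i. THE x. att g i x) ` {..<h}"
  proof
    fix x assume "x \<in> {q \<in> {..<H}. \<exists>v\<in>C. (v, q) \<in> E}"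
    then obtain l' where "x < H" "l' < 12 * h" "(gv g l', x) \<in> E" using sub by auto
    then obtain i where i: "i < h" "att g i x"
      by (auto simp: edge_gadget_hub touches_def)
    then have "(THE x. att g i x) = x" using att_unique by blast
    then show "x \<in> (\<lambda>i. THE x. att g i x) ` {..<h}" using i by auto
  qed
  then have "card {q \<in> {..<H}. \<exists>v\<in>C. (v, q) \<in> E} \<le> card ((\<lambda>i. THE x. att g i x) ` {..<h})"
    by (intro card_mono) auto
  also have "\<dots> \<le> h" using card_image_le[of "{..<h}"] by fastforce
  finally show "card {q \<in> {..<H}. \<exists>v\<in>C. (v, q) \<in> E} \<le> h" .
qed

section \<open>Soundness: what a triangle partition forces on a gadget\<close>

lemma cycle_neighbour:
  assumes "gadget_adj h l p" "0 < l" "l + 1 < 6 * h"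
  shows "p = l + 1 \<or> p = l - 1 \<or> p = 6 * h + l div 2 \<or> p = 9 * h + (l - 1) div 2"
  using assms h_pos unfolding gadget_adj_def gadget_arc_def by (auto split: if_splits)

lemma not_adj_dummies: "l < 6 * h \<Longrightarrow> \<not> gadget_adj h (6 * h + l div 2) (9 * h + l' div 2)"
  using h_pos unfolding gadget_adj_def gadget_arc_def by (auto split: if_splits)

lemma not_adj_skip: "l + 2 < 6 * h \<Longrightarrow> \<not> gadget_adj h l (l + 2)"
  using h_pos unfolding gadget_adj_def gadget_arc_def by auto

lemma gadget_adj_less: "gadget_adj h l p \<Longrightarrow> l < 12 * h \<and> p < 12 * h"
  using h_pos unfolding gadget_adj_def gadget_arc_def by (auto split: if_splits)

text \<open>The dummy withheld from even edge 0 acts here: \<open>0\<close> sees only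
  \<open>1\<close>, \<open>6 * h - 1\<close> and the last odd dummy, \<open>1\<close> sees only
  \<open>0\<close>, \<open>2\<close> and the first odd dummy, and \<open>3 \<le> h\<close> keeps
  these apart.\<close>

lemma first_edge_common:
  assumes "gadget_adj h 0 p" "gadget_adj h 1 p"
  shows False
  using assms h_pos unfolding gadget_adj_def gadget_arc_def by (auto split: if_splits)

text \<open>An element lying in several sets of a tuple is attached to several ports; this prevents
  its triangle from taking vertices of two different ports.\<close>

lemma adj_ports:
  assumes "gadget_adj h l l'" "l = 6 * i \<or> l = 6 * i + 1" "l' = 6 * i' \<or> l' = 6 * i' + 1" "i < h" "i' < h"
  shows "i = i'"
proof -
  have "l < 6 * h" "l' < 6 * h" using assms(2-5) by linarith+
  then have cases: "l' = l + 1 \<or> l = l' + 1 \<or> l = 6 * h - 1 \<or> l' = 6 * h - 1"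
    using assms(1) unfolding gadget_adj_def gadget_arc_def by auto
  have div: "i = l div 6" "i' = l' div 6" using assms(2,3) by (elim disjE; simp)+
  have mod: "l mod 6 \<le> 1" "l' mod 6 \<le> 1" using assms(2,3) by (elim disjE; simp)+
  from cases show ?thesis
  proof (elim disjE)
    assume "l = 6 * h - 1"
    then show ?thesis using wrap_mod6[of h] mod h_pos by simp
  next
    assume "l' = 6 * h - 1"
    then show ?thesis using wrap_mod6[of h] mod h_pos by simp
  qed (use consecutive_div6 div mod in metis)+
qed

lemma neighbour_cases:
  assumes "l < 12 * h" "(gv g l, v) \<in> E"
  obtains (hub) i where "i < h" "v < H" "att g i v" "l = 6 * i \<or> l = 6 * i + 1"
  | (gadget) l' where "l' < 12 * h" "v = gv g l'" "gadget_adj h l l'"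
proof -
  have "v < N" using assms by (auto simp: E_def)
  then show thesis
  proof (cases rule: gv_cases)
    case 1
    then show ?thesis using assms hub by (auto simp: edge_gadget_hub touches_def)
  next
    case (2 g' l')
    then show ?thesis using assms gadget by (auto simp: edge_gadget)
  qed
qed

lemma triangle_at:
  assumes "is_triangle E T" "u \<in> T"
  obtains p q where "T = {u, p, q}" "(u, p) \<in> E" "(u, q) \<in> E" "(p, q) \<in> E"
proof -
  obtain a b c where T: "T = {a, b, c}" "(a, b) \<in> E" "(b, c) \<in> E" "(a, c) \<in> E"
    using assms(1) unfolding is_triangle_def by blast
  then have "(b, a) \<in> E" "(c, b) \<in> E" "(c, a) \<in> E" using E_sym by blast+
  moreover have "T = {b, a, c}" "T = {c, a, b}" using T(1) by auto
  ultimately show thesis using T assms(2) that[of b c] that[of a c] that[of a b] by auto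
qed

text \<open>Without a cycle neighbour, the two partners would be among the hub vertex, the even
  dummy and the odd dummy of \<open>l\<close>, and these are pairwise non-adjacent.\<close>

lemma cycle_triangle:
  assumes "is_triangle E T" "gv g l \<in> T" "0 < l" "l + 1 < 6 * h"
  shows "gv g (l + 1) \<in> T \<or> gv g (l - 1) \<in> T"
proof -
  obtain p q where T: "T = {gv g l, p, q}" "(gv g l, p) \<in> E" "(gv g l, q) \<in> E" "(p, q) \<in> E"
    using assms(1,2) by (rule triangle_at)
  have l: "l < 12 * h" using assms(4) by simp
  \<comment> \<open>A gadget vertex adjacent to a hub vertex is a port vertex, hence lies on the
    cycle and is no dummy.\<close>
  have mixed: "v = gv g (l + 1) \<or> v = gv g (l - 1)"
    if port: "i < h" "x < H" "att g i x" "l = 6 * i \<or> l = 6 * i + 1"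
      "l' < 12 * h" "v = gv g l'" "gadget_adj h l l'" "(v, x) \<in> E" for i x l' v
  proof -
    obtain i' where "i' < h" "l' = 6 * i' \<or> l' = 6 * i' + 1"
      using port(2,5,6,8) by (auto simp: edge_gadget_hub touches_def)
    then have "l' < 6 * h" by auto
    then have "l' = l + 1 \<or> l' = l - 1" using cycle_neighbour[OF port(7) assms(3,4)] by auto
    then show ?thesis using port(6) by auto
  qed
  show ?thesis
    using l T(2)
  proof (cases rule: neighbour_cases)
    case (hub i)
    note p = this
    show ?thesis using l T(3)
    proof (cases rule: neighbour_cases)
      case (hub i')
      have "i' = l div 6" "i = l div 6" using hub(4) p(4) by (elim disjE; simp)+
      then have "i' = i" by simp
      then have "p = q" using att_unique hub p by blast
      then show ?thesis using T(4) simple_graph_E by (auto simp: simple_graph_def irrefl_def)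
    next
      case (gadget l')
      then have "q = gv g (l + 1) \<or> q = gv g (l - 1)"
        using p E_sym[OF T(4)] by (intro mixed[of i p l'])
      then show ?thesis using T(1) by blast
    qed
  next
    case (gadget l')
    note p = this
    show ?thesis using l T(3)
    proof (cases rule: neighbour_cases)
      case (hub i')
      then have "p = gv g (l + 1) \<or> p = gv g (l - 1)"
        using p T(4) by (intro mixed[of i' q l'])
      then show ?thesis using T(1) by blast
    next
      case (gadget l'')
      then have "gadget_adj h l' l''" using T(4) p by (simp add: edge_gadget)
      moreover have "\<not> gadget_adj h (6 * h + l div 2) (9 * h + (l - 1) div 2)"
        using not_adj_dummies assms(4) by simp
      ultimately have "l' \<in> {l - 1, l + 1} \<or> l'' \<in> {l - 1, l + 1}"
        using cycle_neighbour[OF p(3) assms(3,4)] cycle_neighbour[OF gadget(3) assms(3,4)]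
          gadget_adj_irrefl gadget_adj_sym by auto
      then show ?thesis using T(1) p gadget by auto
    qed
  qed
qed

context
  fixes P assumes P: "partition_on {..<N} P" "\<forall>T\<in>P. is_triangle E T"
begin

definition edge_used :: "nat \<Rightarrow> nat \<Rightarrow> bool" where
  "edge_used g l \<longleftrightarrow> (\<exists>T\<in>P. gv g l \<in> T \<and> gv g (l + 1) \<in> T)"

lemma same_block: "T \<in> P \<Longrightarrow> T' \<in> P \<Longrightarrow> u \<in> T \<Longrightarrow> u \<in> T' \<Longrightarrow> T = T'"
  using P(1) by (auto simp: partition_on_def disjoint_def)

lemma triangle_edge: "T \<in> P \<Longrightarrow> u \<in> T \<Longrightarrow> v \<in> T \<Longrightarrow> u \<noteq> v \<Longrightarrow> (u, v) \<in> E"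
  using P(2) triangle_at[of T u] by (metis insertE singletonD)

text \<open>The matching is pushed towards 0: the triangle of \<open>l + 1\<close> must use a cycle
  neighbour, and \<open>l + 2\<close> is already taken together with \<open>l + 3\<close>, which is
  not adjacent to \<open>l + 1\<close>.\<close>

lemma edge_used_down:
  assumes "g < G" "edge_used g (l + 2)" "l + 3 < 6 * h"
  shows "edge_used g l"
proof -
  obtain T where T: "T \<in> P" "gv g (l + 2) \<in> T" "gv g (l + 3) \<in> T"
    using assms(2) by (auto simp: edge_used_def numeral_eq_Suc)
  have "gv g (l + 1) < N" using assms by simp
  then obtain T' where T': "T' \<in> P" "gv g (l + 1) \<in> T'"
    using P(1) by (auto simp: partition_on_def)
  have "gv g (l + 1 + 1) \<in> T' \<or> gv g (l + 1 - 1) \<in> T'"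
    using P(2) T' assms(3) by (intro cycle_triangle) auto
  moreover have False if "gv g (l + 2) \<in> T'"
  proof -
    have "T = T'" using same_block T T' that by blast
    moreover have "gv g (l + 1) \<noteq> gv g (l + 3)" using assms by (simp add: gv_inject)
    ultimately have "(gv g (l + 1), gv g (l + 3)) \<in> E" using triangle_edge T T' by blast
    then have "gadget_adj h (l + 1) (l + 1 + 2)"
      using assms by (simp add: edge_gadget numeral_eq_Suc)
    then show False using not_adj_skip[of "l + 1"] assms(3) by simp
  qed
  ultimately show ?thesis using T' by (auto simp: edge_used_def)
qed

lemma edge_used_zero: "g < G \<Longrightarrow> edge_used g (2 * k) \<Longrightarrow> 2 * k + 1 < 6 * h \<Longrightarrow> edge_used g 0"
proof (induction k)
  case (Suc k)
  have "edge_used g (2 * k + 2)" using Suc.prems(2) by (simp add: algebra_simps)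
  moreover have "2 * k + 3 < 6 * h" using Suc.prems(3) by simp
  ultimately have "edge_used g (2 * k)" using Suc.prems(1) edge_used_down[of g "2 * k"] by blast
  moreover have "2 * k + 1 < 6 * h" using Suc.prems(3) by simp
  ultimately show ?case using Suc.IH Suc.prems(1) by blast
qed simp

text \<open>The edge needs a third vertex; no vertex of the gadget sees both ends, so it comes from
  port 0, where only the token is attached.\<close>

lemma token_used:
  assumes "g < G" "edge_used g 0"
  shows "\<exists>T\<in>P. gv g 0 \<in> T \<and> n + tok g \<in> T"
proof -
  obtain T where T: "T \<in> P" "gv g 0 \<in> T" "gv g 1 \<in> T"
    using assms(2) by (auto simp: edge_used_def)
  obtain p q where pq: "T = {gv g 0, p, q}" "(gv g 0, p) \<in> E" "(gv g 0, q) \<in> E" "(p, q) \<in> E"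
    using P(2) T(1,2) triangle_at by blast
  have ne: "gv g 0 \<noteq> gv g 1" using h_pos by (simp add: gv_inject)
  obtain v where v: "v \<in> T" "(gv g 0, v) \<in> E" "(gv g 1, v) \<in> E"
  proof (cases "p = gv g 1")
    case True
    then show ?thesis using pq that by auto
  next
    case False
    then have "q = gv g 1" using pq(1) T(3) ne by auto
    then show ?thesis using pq E_sym that by auto
  qed
  have "0 < 12 * h" using h_pos by simp
  then show ?thesis using v(2)
  proof (cases rule: neighbour_cases)
    case (hub i)
    then have "v = n + tok g" using att_token by simp
    then show ?thesis using T v by blast
  next
    case (gadget l')
    then have "gadget_adj h 1 l'" using v(3) h_pos by (simp add: edge_gadget)
    then show ?thesis using gadget first_edge_common by blast
  qed
qed

text \<open>An element is adjacent to port vertices only, so its triangle contains an entire port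
  edge. That edge is an even one, which lets \<open>edge_used_zero\<close> carry the matching down
  to the edge of the token.\<close>

lemma element_used:
  assumes "x < n"
  obtains g i where "g < G" "i < h" "att g i x" "edge_used g 0"
proof -
  have xH: "x < H" using assms by (simp add: H_def)
  then have "x < N" using H_le_N by simp
  then obtain T where T: "T \<in> P" "x \<in> T" using P(1) by (auto simp: partition_on_def)
  then obtain p q where pq: "T = {x, p, q}" "(x, p) \<in> E" "(x, q) \<in> E" "(p, q) \<in> E"
    using P(2) triangle_at by blast
  have nb: "\<exists>g l i. g < G \<and> l < 12 * h \<and> v = gv g l \<and> i < h \<and> att g i x \<and> (l = 6 * i \<or> l = 6 * i + 1)"
    if "(x, v) \<in> E" for v
  proof -
    have "v < N" using that by (auto simp: E_def)
    then show ?thesis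
    proof (cases rule: gv_cases)
      case 1
      then show ?thesis using that assms xH edge_hub by auto
    next
      case (2 g l)
      then show ?thesis using that xH by (auto simp: edge_hub_gadget touches_def)
    qed
  qed
  obtain g l i where g: "g < G" "l < 12 * h" "p = gv g l" "i < h" "att g i x" "l = 6 * i \<or> l = 6 * i + 1"
    using nb[OF pq(2)] by blast
  obtain g' l' i' where g': "l' < 12 * h" "q = gv g' l'" "i' < h" "l' = 6 * i' \<or> l' = 6 * i' + 1"
    using nb[OF pq(3)] by blast
  have "g' = g" "gadget_adj h l l'" using pq(4) g g' by (auto simp: edge_gadget)
  then have "i' = i" using adj_ports[of l l' i i'] g g' by simp
  moreover have "l \<noteq> l'" using \<open>gadget_adj h l l'\<close> gadget_adj_irrefl by blast
  ultimately have "gv g (6 * i) \<in> T" "gv g (6 * i + 1) \<in> T"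
    using pq(1) g g' \<open>g' = g\<close> by auto
  then have "edge_used g (2 * (3 * i))" using T by (auto simp: edge_used_def)
  then have "edge_used g 0" using edge_used_zero[of g "3 * i"] g by simp
  then show thesis using that g by blast
qed

end

text \<open>\<open>S\<close> consists of the gadgets whose first cycle edge is used. If two of them
  had the same token, its triangle would contain vertices of both, but distinct gadgets are not
  joined.\<close>

lemma triangle_partition_sound:
  assumes "triangle_partition {..<N} E"
  obtains S where "S \<subseteq> {..<G}" "inj_on tok S" "\<And>x. x < n \<Longrightarrow> \<exists>g\<in>S. \<exists>i<h. att g i x"
proof -
  obtain P where P: "partition_on {..<N} P" "\<forall>T\<in>P. is_triangle E T"
    using assms unfolding triangle_partition_def by blast
  define S where "S = {g. g < G \<and> edge_used P g 0}"
  have "inj_on tok S"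
  proof (rule inj_onI)
    fix g g' assume g: "g \<in> S" "g' \<in> S" "tok g = tok g'"
    have "g < G" "edge_used P g 0" "g' < G" "edge_used P g' 0" using g(1,2) unfolding S_def by auto
    then obtain T T' where T: "T \<in> P" "gv g 0 \<in> T" "n + tok g \<in> T"
        "T' \<in> P" "gv g' 0 \<in> T'" "n + tok g \<in> T'"
      using token_used[OF P, of g] token_used[OF P, of g'] g(3) by metis
    then have TT: "T = T'" using same_block[OF P] by blast
    show "g = g'"
    proof (rule ccontr)
      assume "g \<noteq> g'"
      then have "gv g 0 \<noteq> gv g' 0" using h_pos by (simp add: gv_inject)
      then have "(gv g 0, gv g' 0) \<in> E" using triangle_edge[OF P] T TT by blast
      then show False using h_pos \<open>g \<noteq> g'\<close> by (simp add: edge_gadget)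
    qed
  qed
  moreover have "\<exists>g\<in>S. \<exists>i<h. att g i x" if x: "x < n" for x
  proof -
    obtain g i where "g < G" "i < h" "att g i x" "edge_used P g 0"
      using element_used[OF P x] by metis
    then show ?thesis unfolding S_def by blast
  qed
  ultimately show thesis using that[of S] by (auto simp: S_def)
qed

section \<open>Completeness: building a triangle partition\<close>

lemma gv_inject_local [simp]: "gv g l = gv g l' \<longleftrightarrow> l = l'"
  by (simp add: gv_def)

lemma gadget_disjoint: "g \<noteq> g' \<Longrightarrow> gv g ` {..<12 * h} \<inter> gv g' ` {..<12 * h} = {}"
  by (auto simp: gv_inject)

lemma gadget_adj_facts:
  "l + 1 < 6 * h \<Longrightarrow> gadget_adj h l (l + 1)"
  "gadget_adj h (6 * h - 1) 0"
  "0 < k \<Longrightarrow> k < 3 * h \<Longrightarrow> gadget_adj h (2 * k) (6 * h + k)"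
  "0 < k \<Longrightarrow> k < 3 * h \<Longrightarrow> gadget_adj h (2 * k + 1) (6 * h + k)"
  "k < 3 * h \<Longrightarrow> gadget_adj h (2 * k + 1) (9 * h + k)"
  "k + 1 < 3 * h \<Longrightarrow> gadget_adj h (2 * k + 2) (9 * h + k)"
  "gadget_adj h 0 (9 * h + (3 * h - 1))"
  using h_pos unfolding gadget_adj_def gadget_arc_def by auto

lemma edge_gadgetI: "g < G \<Longrightarrow> gadget_adj h l l' \<Longrightarrow> (gv g l, gv g l') \<in> E"
  using gadget_adj_less edge_gadget by blast

lemma dummies_partition:
  assumes "g < G" "K \<subseteq> {6 * h..<9 * h} \<or> K \<subseteq> {9 * h..<12 * h}" "3 dvd card K"
  shows "triangle_partition (gv g ` K) E"
proof (rule triangle_partition_clique)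
  show "finite (gv g ` K)" using assms(2) finite_subset by blast
  show "3 dvd card (gv g ` K)" using assms(3) by (simp add: card_image inj_on_def)
  fix u v assume "u \<in> gv g ` K" "v \<in> gv g ` K" "u \<noteq> v"
  then obtain l l' where l: "u = gv g l" "v = gv g l'" "l \<in> K" "l' \<in> K" "l \<noteq> l'" by auto
  have "gadget_arc h l l'" if "l < l'" "l \<in> K" "l' \<in> K" for l l'
  proof -
    have "6 * h \<le> l \<and> l' < 9 * h \<or> 9 * h \<le> l \<and> l' < 12 * h" using assms(2) that(2,3) by auto
    then show ?thesis using that(1) unfolding gadget_arc_def by blast
  qed
  then have "gadget_adj h l l'"
    using l(3-5) unfolding gadget_adj_def by (metis linorder_neq_iff)
  then show "(u, v) \<in> E" using l assms(1) edge_gadgetI by simp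
qed

text \<open>The odd matching: edge \<open>k\<close> takes the dummy \<open>9 * h + k\<close>. All
  \<open>3 * h\<close> even dummies remain and are partitioned within their clique.\<close>

lemma gadget_off:
  assumes "g < G"
  shows "triangle_partition (gv g ` {..<12 * h}) E"
proof -
  \<comment> \<open>The far end of odd edge \<open>k\<close>, wrapping to 0 for the last
    edge.\<close>
  define nxt where "nxt k = (if k + 1 < 3 * h then 2 * k + 2 else 0)" for k
  let ?T = "\<lambda>k. {gv g (2 * k + 1), gv g (nxt k), gv g (9 * h + k)}"
  have nxt: "nxt k < 6 * h" "even (nxt k)" "nxt k = nxt k' \<Longrightarrow> k < 3 * h \<Longrightarrow> k' < 3 * h \<Longrightarrow> k = k'" for k k'
    using h_pos by (auto simp: nxt_def split: if_splits)
  have "triangle_partition (?T k) E" if "k < 3 * h" for k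
  proof (rule triangle_partition_triangle)
    show "(gv g (2 * k + 1), gv g (nxt k)) \<in> E"
    proof (cases "k + 1 < 3 * h")
      case True
      then show ?thesis using assms edge_gadgetI gadget_adj_facts(1)[of "2 * k + 1"] by (simp add: nxt_def)
    next
      case False
      then have "2 * k + 1 = 6 * h - 1" using that by simp
      then show ?thesis using False assms edge_gadgetI gadget_adj_facts(2) by (simp add: nxt_def)
    qed
    show "(gv g (nxt k), gv g (9 * h + k)) \<in> E"
    proof (cases "k + 1 < 3 * h")
      case True
      then show ?thesis using assms edge_gadgetI gadget_adj_facts(6) by (simp add: nxt_def)
    next
      case False
      then have "k = 3 * h - 1" using that by simp
      then show ?thesis using False assms edge_gadgetI gadget_adj_facts(7) by (simp add: nxt_def)
    qed
    show "(gv g (2 * k + 1), gv g (9 * h + k)) \<in> E"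
      using that assms edge_gadgetI gadget_adj_facts(5) by simp
  qed
  moreover have "disjoint_family_on ?T {..<3 * h}"
    unfolding disjoint_family_on_def
  proof (intro ballI impI)
    fix k k' assume k: "k \<in> {..<3 * h}" "k' \<in> {..<3 * h}" "k \<noteq> k'"
    have "2 * k + 1 \<noteq> nxt k'" "2 * k' + 1 \<noteq> nxt k"
      by (metis nxt(2) even_plus_one_iff dvd_triv_left)+
    moreover have "nxt k \<noteq> nxt k'" using nxt(3)[of k k'] k by blast
    moreover have "2 * k + 1 < 9 * h" "2 * k' + 1 < 9 * h" "nxt k < 9 * h" "nxt k' < 9 * h"
      using k nxt(1)[of k] nxt(1)[of k'] by auto
    ultimately show "?T k \<inter> ?T k' = {}" using k by auto
  qed
  ultimately have 1: "triangle_partition (\<Union>k<3 * h. ?T k) E"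
    by (intro triangle_partition_UN) auto
  have 2: "triangle_partition (gv g ` {6 * h..<9 * h}) E"
    using assms by (intro dummies_partition) auto
  have "(\<Union>k<3 * h. ?T k) \<inter> gv g ` {6 * h..<9 * h} = {}"
    using nxt(1) by (auto simp: not_le)
      (metis mult.commute mult_2 not_le not_less_eq)+
  then have "triangle_partition ((\<Union>k<3 * h. ?T k) \<union> gv g ` {6 * h..<9 * h}) E"
    using 1 2 by (intro triangle_partition_Un)
  moreover have "(\<Union>k<3 * h. ?T k) \<union> gv g ` {6 * h..<9 * h} = gv g ` {..<12 * h}"
  proof (intro equalityI subsetI)
    fix v assume "v \<in> (\<Union>k<3 * h. ?T k) \<union> gv g ` {6 * h..<9 * h}"
    moreover have "nxt k < 12 * h" for k using nxt(1)[of k] by simp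
    ultimately show "v \<in> gv g ` {..<12 * h}" by auto
  next
    fix v assume "v \<in> gv g ` {..<12 * h}"
    then obtain l where l: "l < 12 * h" "v = gv g l" by auto
    consider k where "l = 2 * k + 1" "k < 3 * h" | k where "l = nxt k" "k < 3 * h"
      | k where "l = 9 * h + k" "k < 3 * h" | "6 * h \<le> l" "l < 9 * h"
    proof -
      consider "l < 6 * h" "odd l" | "l = 0" | "l < 6 * h" "even l" "0 < l" | "6 * h \<le> l" "l < 9 * h" | "9 * h \<le> l" by linarith
      then show thesis
      proof cases
        case 1
        then have "l div 2 < 3 * h" by (simp add: div_less_iff_less_mult)
        moreover have "l = 2 * (l div 2) + 1" using 1 by simp
        ultimately show ?thesis using that(1) by blast
      next
        case 2
        then show ?thesis using that(2)[of "3 * h - 1"] h_pos by (simp add: nxt_def)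
      next
        case 3
        then obtain m where "l = 2 * m" by auto
        then show ?thesis using that(2)[of "m - 1"] 3 by (simp add: nxt_def)
      next
        case 4
        then show ?thesis using that(4) by simp
      next
        case 5
        then show ?thesis using that(3)[of "l - 9 * h"] l by simp
      qed
    qed
    then show "v \<in> (\<Union>k<3 * h. ?T k) \<union> gv g ` {6 * h..<9 * h}"
      using l(2) by cases auto
  qed
  ultimately show ?thesis by simp
qed

text \<open>The even matching: edge \<open>3 * p x\<close> takes the hub vertex \<open>x\<close>,
  every other edge \<open>k\<close> takes its dummy \<open>6 * h + k\<close>. Left over are
  \<open>card Z\<close> even dummies and all \<open>3 * h\<close> odd ones; both counts are
  multiples of 3, so their cliques can be partitioned.\<close>

lemma gadget_on:
  assumes g: "g < G" and Z: "Z \<subseteq> {..<H}" "3 dvd card Z" "n + tok g \<in> Z"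
    and port: "\<And>x. x \<in> Z \<Longrightarrow> p x < h \<and> att g (p x) x" and "p (n + tok g) = 0"
  shows "triangle_partition (Z \<union> gv g ` {..<12 * h}) E"
proof -
  have fin: "finite Z" using Z(1) finite_subset by blast
  have inj: "inj_on p Z" using port att_unique by (metis inj_onI)
  define K where "K = (\<lambda>x. 3 * p x) ` Z"
  have K: "K \<subseteq> {..<3 * h}" using port unfolding K_def by auto
  \<comment> \<open>No dummy completes edge 0, so the token has to be in \<open>Z\<close> for
    it.\<close>
  have K0: "0 \<in> K" using Z(3) assms(6) unfolding K_def by force
  have cardK: "card K = card Z"
    unfolding K_def using inj by (intro card_image) (auto simp: inj_on_def)
  let ?A = "\<lambda>x. {gv g (6 * p x), gv g (6 * p x + 1), x}"
  let ?B = "\<lambda>k. {gv g (2 * k), gv g (2 * k + 1), gv g (6 * h + k)}"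
  let ?L = "{..<3 * h} - K"
  have A: "triangle_partition (\<Union>x\<in>Z. ?A x) E"
  proof (rule triangle_partition_UN[OF fin])
    fix x assume x: "x \<in> Z"
    then have "touches h att g (6 * p x) x" "touches h att g (6 * p x + 1) x" "x < H" "p x < h"
      using port[OF x] Z(1) unfolding touches_def by auto
    then show "triangle_partition (?A x) E"
      using g by (intro triangle_partition_triangle) (auto simp: edge_gadget_hub intro!: edge_gadgetI gadget_adj_facts(1)[of "6 * p x", simplified])
  next
    show "disjoint_family_on ?A Z"
      unfolding disjoint_family_on_def
    proof (intro ballI impI)
      fix x x' assume x: "x \<in> Z" "x' \<in> Z" "x \<noteq> x'"
      then have "p x \<noteq> p x'" using inj by (auto dest: inj_onD)
      moreover have "6 * p x \<noteq> 6 * p x' + 1" "6 * p x' \<noteq> 6 * p x + 1" by presburger+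
      ultimately show "?A x \<inter> ?A x' = {}" using x Z(1) gv_ne_hub by auto
    qed
  qed
  have B: "triangle_partition (\<Union>k\<in>?L. ?B k) E"
  proof (rule triangle_partition_UN)
    fix k assume "k \<in> ?L"
    then have "k < 3 * h" "0 < k" using K0 by (auto intro: gr0I)
    then show "triangle_partition (?B k) E"
      using g gadget_adj_facts(1)[of "2 * k"] gadget_adj_facts(3,4)[of k]
      by (intro triangle_partition_triangle edge_gadgetI) auto
  next
    show "disjoint_family_on ?B ?L"
      unfolding disjoint_family_on_def
    proof (intro ballI impI)
      fix k k' assume k: "k \<in> ?L" "k' \<in> ?L" "k \<noteq> k'"
      moreover have "2 * k \<noteq> 2 * k' + 1" "2 * k' \<noteq> 2 * k + 1" by presburger+
      ultimately show "?B k \<inter> ?B k' = {}" by auto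
    qed
  qed simp
  let ?D = "(\<lambda>k. 6 * h + k) ` K"
  have D: "triangle_partition (gv g ` ?D) E"
    using g K cardK Z(2) by (intro dummies_partition) (auto simp: card_image)
  have X: "triangle_partition (gv g ` {9 * h..<12 * h}) E"
    using g by (intro dummies_partition) auto
  have AB: "(\<Union>x\<in>Z. ?A x) \<inter> (\<Union>k\<in>?L. ?B k) = {}"
  proof -
    have "?A x \<inter> ?B k = {}" if "x \<in> Z" "k \<in> ?L" for x k
    proof -
      have "k \<noteq> 3 * p x" using that unfolding K_def by auto
      then have "2 * k \<noteq> 6 * p x" "2 * k + 1 \<noteq> 6 * p x" "2 * k \<noteq> 6 * p x + 1" by presburger+
      moreover have "p x < h" "x < H" using that port Z(1) by auto
      ultimately show ?thesis using gv_ne_hub by auto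
    qed
    then show ?thesis by blast
  qed
  have ABD: "((\<Union>x\<in>Z. ?A x) \<union> (\<Union>k\<in>?L. ?B k)) \<inter> gv g ` ?D = {}"
  proof -
    have "?A x \<inter> gv g ` ?D = {}" if "x \<in> Z" for x
      using that port[OF that] Z(1) gv_ne_hub by auto
    moreover have "?B k \<inter> gv g ` ?D = {}" if "k \<in> ?L" for k
      using that by auto
    ultimately show ?thesis by blast
  qed
  have ABDX: "((\<Union>x\<in>Z. ?A x) \<union> (\<Union>k\<in>?L. ?B k) \<union> gv g ` ?D) \<inter> gv g ` {9 * h..<12 * h} = {}"
  proof -
    have "?A x \<inter> gv g ` {9 * h..<12 * h} = {}" if "x \<in> Z" for x
      using that port[OF that] Z(1) gv_ne_hub by auto
    moreover have "?B k \<inter> gv g ` {9 * h..<12 * h} = {}" if "k \<in> ?L" for k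
      using that by auto
    moreover have "gv g ` ?D \<inter> gv g ` {9 * h..<12 * h} = {}"
      using K by auto
    ultimately show ?thesis by (rule UN_UN_Un_disjoint)
  qed
  have "triangle_partition ((\<Union>x\<in>Z. ?A x) \<union> (\<Union>k\<in>?L. ?B k) \<union> gv g ` ?D \<union> gv g ` {9 * h..<12 * h}) E"
    by (intro triangle_partition_Un A B D X AB ABD ABDX)
  moreover have "(\<Union>x\<in>Z. ?A x) \<union> (\<Union>k\<in>?L. ?B k) \<union> gv g ` ?D \<union> gv g ` {9 * h..<12 * h} =
      Z \<union> gv g ` {..<12 * h}" (is "?l = ?r")
  proof (rule equalityI[OF _ subsetI])
    have "?A x \<subseteq> ?r" if "x \<in> Z" for x using that port[OF that] by auto
    moreover have "?B k \<subseteq> ?r" if "k \<in> ?L" for k using that by auto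
    moreover have "gv g ` ?D \<subseteq> ?r" using K by auto
    moreover have "gv g ` {9 * h..<12 * h} \<subseteq> ?r" by auto
    ultimately show "?l \<subseteq> ?r" by (rule UN_UN_Un_Un_subset)
  next
    fix v assume "v \<in> ?r"
    then consider "v \<in> Z" | l where "v = gv g l" "l < 12 * h" by auto
    then show "v \<in> ?l"
    proof cases
      case 1
      then show ?thesis by auto
    next
      case (2 l)
      consider k where "l = 2 * k \<or> l = 2 * k + 1" "k < 3 * h" | k where "l = 6 * h + k" "k < 3 * h"
        | "9 * h \<le> l"
      proof -
        consider "l < 6 * h" | "6 * h \<le> l" "l < 9 * h" | "9 * h \<le> l" by linarith
        then show thesis
        proof cases
          case 1
          then have "l div 2 < 3 * h" by (simp add: div_less_iff_less_mult)
          moreover have "l = 2 * (l div 2) \<or> l = 2 * (l div 2) + 1" by presburger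
          ultimately show ?thesis using that(1) by blast
        next
          case 2
          then show ?thesis using that(2)[of "l - 6 * h"] by auto
        qed (use that in auto)
      qed
      then show ?thesis
      proof cases
        case (1 k)
        show ?thesis
        proof (cases "k \<in> K")
          case True
          then obtain x where "x \<in> Z" "k = 3 * p x" unfolding K_def by auto
          then have "v \<in> ?A x" using 1 2 by auto
          then show ?thesis using \<open>x \<in> Z\<close> by blast
        next
          case False
          then have "v \<in> ?B k" "k \<in> ?L" using 1 2 by auto
          then show ?thesis by blast
        qed
      next
        case (2 k)
        then show ?thesis using \<open>v = gv g l\<close> by (cases "k \<in> K") auto
      next
        case 3
        then show ?thesis using 2 by auto
      qed
    qed
  qed
  ultimately show ?thesis by simp
qed

text \<open>\<open>s\<close> picks one gadget for every token; \<open>J\<close> and \<open>I\<close>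
  assign each element to a token and to a port of the gadget picked for it. These gadgets absorb all
  elements and tokens, so only padding vertices remain, a clique whose size is a multiple of
  3.\<close>

lemma triangle_partition_complete:
  assumes y: "3 dvd n + a + y" "2 * a \<le> y"
    and pads: "\<And>g. att g 1 (n + a + 2 * tok g)" "\<And>g. att g 2 (n + a + 2 * tok g + 1)"
    and sel: "\<And>j. j < a \<Longrightarrow> s j < G \<and> tok (s j) = j"
    and cov: "\<And>x. x < n \<Longrightarrow> J x < a \<and> I x < h \<and> att (s (J x)) (I x) x"
  shows "triangle_partition {..<N} E"
proof -
  define X where "X j = {x. x < n \<and> J x = j}" for j
  \<comment> \<open>chosen such that the number of hub vertices used by the gadget is divisible by 3\<close>
  define w where "w j = (2 * (1 + card (X j))) mod 3" for j
  define W where "W j = {n + a + 2 * j..<n + a + 2 * j + w j}" for j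
  define Z where "Z j = insert (n + j) (X j \<union> W j)" for j
  define p where "p j x = (if x < n then I x else if x < n + a then 0 else 1 + (x - (n + a + 2 * j)))" for j x
  have w2: "w j \<le> 2" for j
    using mod_less_divisor[of 3 "2 * (1 + card (X j))"] unfolding w_def by linarith
  have finX: "finite (X j)" for j unfolding X_def by simp
  have Z_dvd: "3 dvd card (Z j)" if "j < a" for j
  proof -
    have "X j \<inter> W j = {}" "n + j \<notin> X j \<union> W j" using that by (auto simp: X_def W_def)
    then have "card (Z j) = 1 + card (X j) + w j"
      unfolding Z_def using finX by (simp add: card_Un_disjoint W_def)
    \<comment> \<open>With \<open>c = 1 + card (X j)\<close>, the sum is congruent to
      \<open>3 * c\<close>.\<close>
    also have "3 dvd 1 + card (X j) + w j" unfolding w_def by presburger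
    finally show ?thesis .
  qed
  have W_less: "x < H" "n + a \<le> x" if "j < a" "x \<in> W j" for x j
    using that w2[of j] y(2) by (auto simp: W_def H_def)
  have Z_less: "Z j \<subseteq> {..<H}" if "j < a" for j
    using that W_less[OF that] by (auto simp: Z_def X_def H_def)
  have on: "triangle_partition (Z j \<union> gv (s j) ` {..<12 * h}) E" if j: "j < a" for j
  proof (rule gadget_on)
    show "s j < G" "Z j \<subseteq> {..<H}" "3 dvd card (Z j)" "n + tok (s j) \<in> Z j"
      using sel[OF j] Z_less[OF j] Z_dvd[OF j] by (auto simp: Z_def)
    show "p j (n + tok (s j)) = 0" using sel[OF j] j by (simp add: p_def)
    fix x assume "x \<in> Z j"
    then consider "x = n + j" | "x \<in> X j" | "x \<in> W j" unfolding Z_def by blast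
    then show "p j x < h \<and> att (s j) (p j x) x"
    proof cases
      case 1
      then show ?thesis using sel[OF j] j h_pos by (simp add: p_def att_token)
    next
      case 2
      then show ?thesis using cov[of x] by (auto simp: X_def p_def)
    next
      case 3
      have "x = n + a + 2 * j \<or> x = n + a + 2 * j + 1" using 3 w2[of j] by (auto simp: W_def)
      then show ?thesis using pads[of "s j"] sel[OF j] h_pos by (auto simp: p_def numeral_2_eq_2)
    qed
  qed
  have Z_disj: "Z j \<inter> Z j' = {}" if "j < a" "j' < a" "j \<noteq> j'" for j j'
  proof -
    have "W j \<inter> W j' = {}" using that(3) w2[of j] w2[of j'] by (auto simp: W_def)
    moreover have "X j \<inter> X j' = {}" using that(3) by (auto simp: X_def)
    moreover have "X j \<inter> W j' = {}" "W j \<inter> X j' = {}" by (auto simp: X_def W_def)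
    moreover have "n + j \<notin> X j' \<union> W j'" "n + j' \<notin> X j \<union> W j"
      using that by (auto simp: X_def W_def)
    ultimately show ?thesis using that(3) unfolding Z_def by auto
  qed
  have s_inj: "s j \<noteq> s j'" if "j < a" "j' < a" "j \<noteq> j'" for j j'
    using sel[OF that(1)] sel[OF that(2)] that(3) by auto
  let ?gad = "\<lambda>g. gv g ` {..<12 * h}"
  have hub_gad: "A \<inter> ?gad g = {}" if "A \<subseteq> {..<H}" for A g
    using that gv_ne_hub by blast
  have P1: "triangle_partition (\<Union>j<a. Z j \<union> ?gad (s j)) E"
  proof (rule triangle_partition_UN)
    show "disjoint_family_on (\<lambda>j. Z j \<union> ?gad (s j)) {..<a}"
      unfolding disjoint_family_on_def
    proof (intro ballI impI)
      fix j j' assume j: "j \<in> {..<a}" "j' \<in> {..<a}" "j \<noteq> j'"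
      then have "Z j \<inter> Z j' = {}" "?gad (s j) \<inter> ?gad (s j') = {}"
        using Z_disj s_inj gadget_disjoint by auto
      moreover have "Z j \<inter> ?gad (s j') = {}" "Z j' \<inter> ?gad (s j) = {}"
        using j Z_less hub_gad by auto
      ultimately show "(Z j \<union> ?gad (s j)) \<inter> (Z j' \<union> ?gad (s j')) = {}" by blast
    qed
  qed (use on in auto)
  let ?O = "{..<G} - s ` {..<a}"
  have P2: "triangle_partition (\<Union>g\<in>?O. ?gad g) E"
  proof (rule triangle_partition_UN)
    show "disjoint_family_on ?gad ?O"
      unfolding disjoint_family_on_def using gadget_disjoint by blast
  qed (use gadget_off in auto)
  let ?R = "{..<H} - (\<Union>j<a. Z j)"
  have P3: "triangle_partition ?R E"
  proof (rule triangle_partition_clique)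
    have fin: "finite (\<Union>j<a. Z j)" using finX by (auto simp: Z_def W_def)
    have "card (\<Union>j<a. Z j) = (\<Sum>j<a. card (Z j))"
      using finX Z_disj by (intro card_UN_disjoint) (auto simp: Z_def W_def)
    also have "3 dvd \<dots>" using Z_dvd by (intro dvd_sum) auto
    finally have "3 dvd card (\<Union>j<a. Z j)" .
    moreover have "card ?R = H - card (\<Union>j<a. Z j)"
      using fin Z_less by (subst card_Diff_subset) auto
    ultimately show "3 dvd card ?R" using y(1) by (simp add: H_def)
    fix u v assume uv: "u \<in> ?R" "v \<in> ?R" "u \<noteq> v"
    have "n + a \<le> x" if "x \<in> ?R" for x
    proof (rule ccontr)
      assume "\<not> n + a \<le> x"
      then consider "x < n" | j where "j < a" "x = n + j"
        by (metis add_diff_inverse_nat add_less_cancel_left not_le)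
      then have "x \<in> (\<Union>j<a. Z j)"
        by cases (use cov in \<open>auto simp: Z_def X_def\<close>)
      then show False using that by blast
    qed
    then show "(u, v) \<in> E" using uv edge_hub[of u v] by auto
  qed simp
  have 12: "(\<Union>j<a. Z j \<union> ?gad (s j)) \<inter> (\<Union>g\<in>?O. ?gad g) = {}"
  proof -
    have "(Z j \<union> ?gad (s j)) \<inter> ?gad g = {}" if "j < a" "g \<in> ?O" for j g
      using that hub_gad[OF Z_less[OF that(1)], of g] gadget_disjoint[of "s j" g] by blast
    then show ?thesis by blast
  qed
  have 123: "((\<Union>j<a. Z j \<union> ?gad (s j)) \<union> (\<Union>g\<in>?O. ?gad g)) \<inter> ?R = {}"
  proof -
    have "?R \<inter> ?gad g = {}" for g using hub_gad[of ?R g] by blast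
    then show ?thesis by blast
  qed
  have "triangle_partition ((\<Union>j<a. Z j \<union> ?gad (s j)) \<union> (\<Union>g\<in>?O. ?gad g) \<union> ?R) E"
    by (intro triangle_partition_Un P1 P2 P3 12 123)
  moreover have "(\<Union>j<a. Z j \<union> ?gad (s j)) \<union> (\<Union>g\<in>?O. ?gad g) \<union> ?R = {..<N}" (is "?l = _")
  proof (rule equalityI[OF _ subsetI])
    have gad: "?gad g \<subseteq> {..<N}" if "g < G" for g using that by auto
    have "Z j \<union> ?gad (s j) \<subseteq> {..<N}" if "j < a" for j
      using Z_less[OF that] H_le_N gad[of "s j"] sel[OF that] by auto
    then have "(\<Union>j<a. Z j \<union> ?gad (s j)) \<subseteq> {..<N}" by (intro UN_least) simp
    moreover have "(\<Union>g\<in>?O. ?gad g) \<subseteq> {..<N}" using gad by (intro UN_least) simp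
    moreover have "?R \<subseteq> {..<N}" using H_le_N by auto
    ultimately show "?l \<subseteq> {..<N}" by (intro Un_least)
  next
    fix v assume "v \<in> {..<N}"
    then have "v < N" by simp
    then show "v \<in> ?l"
    proof (cases rule: gv_cases)
      case 1
      then show ?thesis by blast
    next
      case (2 g l)
      then have "v \<in> ?gad g" by blast
      then show ?thesis using 2(1) by (cases "g \<in> s ` {..<a}") blast+
    qed
  qed
  ultimately show ?thesis by simp
qed

end

section \<open>From Set Cover to Triangle Partition\<close>

text \<open>Base \<open>M\<close> numerals: one number below \<open>M ^ q\<close> codes any given
  \<open>q\<close>-tuple of indices, so every tuple has a gadget for each token.\<close>

lemma ex_digits:
  fixes M :: nat
  assumes "\<And>r. r < q \<Longrightarrow> f r < M"
  shows "\<exists>w<M ^ q. \<forall>r<q. w div M ^ r mod M = f r"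
  using assms
proof (induction q arbitrary: f)
  case 0
  then show ?case by simp
next
  case (Suc q)
  obtain w where w: "w < M ^ q" "\<And>r. r < q \<Longrightarrow> w div M ^ r mod M = f (Suc r)"
    using Suc.IH[of "\<lambda>r. f (Suc r)"] Suc.prems by auto
  have f0: "f 0 < M" using Suc.prems by simp
  have "Suc w * M \<le> M ^ q * M" using w(1) by (intro mult_right_mono) auto
  then have "f 0 + w * M < M ^ Suc q" using f0 by (simp add: mult.commute)
  moreover have "(f 0 + w * M) div M ^ r mod M = f r" if "r < Suc q" for r
  proof (cases r)
    case 0
    then show ?thesis using f0 by simp
  next
    case (Suc r')
    have "(f 0 + w * M) div M ^ r = (f 0 + w * M) div M div M ^ r'"
      by (simp add: Suc div_mult2_eq)
    also have "(f 0 + w * M) div M = w" using f0 by simp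
    finally show ?thesis using w(2) that Suc by simp
  qed
  ultimately show ?case by blast
qed

locale reduction =
  fixes d q n t :: nat and F :: "nat set set" and Fs :: "nat list list"
  assumes d_pos: "1 \<le> d" and q_pos: "1 \<le> q"
    and inst: "set_cover_instance d {..<n} F" and fam: "lists_family Fs F"
begin

text \<open>
  \<open>pt i\<close> is the position of the \<open>i\<close>-th set in the input. The pair of group \<open>j\<close> and index \<open>r < q\<close> may
  choose a set iff digit number \<open>q * j + r\<close> of the unary number \<open>t\<close> is present. \<open>M\<close> replaces \<open>m = 0\<close>,
  which occurs for \<open>n = 0\<close>, by 1, so that every token has a gadget.
\<close>

definition "m = length Fs"
definition "M = m + (1 - m)"
definition "a = n div q + 1"
text \<open>Two padding vertices per group, plus the remainder that makes
  \<open>n + a + y = 3 * a + (n + (2 * n) mod 3)\<close> divisible by 3.\<close>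

definition "y = 2 * a + (2 * n) mod 3"
text \<open>Three ports for the token and the padding, then \<open>d\<close> ports for each of the
  \<open>q\<close> sets of the tuple.\<close>

definition "h = d * q + 3"
definition "G = a * M ^ q"
definition "inp = input_mem (encode_set_cover n Fs t) 0"
definition "pt i = 2 + (\<Sum>l<i. 1 + length (Fs ! l))"
definition "tok g = g mod a"
definition "dig g r = g div a div M ^ r mod M"
text \<open>Gadget \<open>g\<close> belongs to token \<open>g mod a\<close>, and
  \<open>g div a\<close> codes its tuple. Port \<open>3 + (r * d + k)\<close> carries entry
  \<open>k\<close> of the set chosen by digit \<open>r\<close>. All is read from the raw input, so
  that a program can evaluate the same formula.\<close>

definition "att g i x \<longleftrightarrow>
  (if i = 0 then x = n + tok g
   else if i = 1 then x = n + a + 2 * tok g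
   else if i = 2 then x = n + a + 2 * tok g + 1
   else x < n \<and> inp (pt m + (q * tok g + (i - 3) div d)) \<noteq> 0 \<and>
     (i - 3) mod d < inp (pt (dig g ((i - 3) div d))) \<and>
     x = inp (pt (dig g ((i - 3) div d)) + (1 + (i - 3) mod d)))"

lemma a_pos: "0 < a" by (simp add: a_def)
lemma M_pos: "0 < M" unfolding M_def by linarith
lemma tok_less: "tok g < a" using a_pos by (simp add: tok_def)
lemma dig_less: "dig g r < M" using M_pos by (simp add: dig_def)

lemma dig_le: "dig g r \<le> m"
  using dig_less[of g r] by (auto simp: M_def)

sublocale hub_graph n a y h G tok att
proof
  show "3 \<le> h" by (simp add: h_def)
  show "att g 0 x \<longleftrightarrow> x = n + tok g" for g x by (simp add: att_def)
  show "att g i x \<Longrightarrow> x < n + a + y" for g i x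
    using tok_less[of g] by (auto simp: att_def y_def split: if_splits)
  show "att g i x \<Longrightarrow> att g i x' \<Longrightarrow> x = x'" for g i x x'
    by (auto simp: att_def split: if_splits)
qed (rule tok_less)

lemma set_Fs: "i < m \<Longrightarrow> set (Fs ! i) \<in> F" "S \<in> F \<Longrightarrow> \<exists>i<m. S = set (Fs ! i)"
  using fam unfolding lists_family_def m_def by (auto, metis in_set_conv_nth)

lemma length_Fs: "i < m \<Longrightarrow> length (Fs ! i) \<le> d"
  using set_Fs(1)[of i] inst fam distinct_card[of "Fs ! i"]
  unfolding lists_family_def m_def set_cover_instance_def by (metis nth_mem)

lemma Fs_less: "i < m \<Longrightarrow> x \<in> set (Fs ! i) \<Longrightarrow> x < n"
  using set_Fs(1)[of i] inst unfolding set_cover_instance_def by blast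

lemma length_concat_take:
  "i \<le> m \<Longrightarrow> length (concat (map (\<lambda>S. length S # S) (take i Fs))) = (\<Sum>l<i. 1 + length (Fs ! l))"
  by (induction i) (simp_all add: take_Suc_conv_app_nth m_def)

lemma inp_nth: "inp i = (if i < length (encode_set_cover n Fs t) then encode_set_cover n Fs t ! i else 0)"
  by (simp add: inp_def input_mem_def)

lemma inp_0: "inp 0 = n" and inp_1: "inp 1 = m"
  by (simp_all add: inp_nth encode_set_cover_def m_def)

lemma inp_pt:
  assumes "i < m" "k \<le> length (Fs ! i)"
  shows "inp (pt i + k) = (length (Fs ! i) # Fs ! i) ! k"
proof -
  let ?g = "\<lambda>S :: nat list. length S # S"
  let ?A = "concat (map ?g (take i Fs))"
  let ?B = "concat (map ?g (drop (Suc i) Fs)) @ replicate t 1"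
  have "map ?g Fs = map ?g (take i Fs) @ ?g (Fs ! i) # map ?g (drop (Suc i) Fs)"
    using id_take_nth_drop[of i Fs] assms(1) unfolding m_def
    by (metis (no_types, lifting) list.simps(9) map_append)
  then have enc: "encode_set_cover n Fs t = n # length Fs # ?A @ ?g (Fs ! i) @ ?B"
    unfolding encode_set_cover_def by simp
  have pt: "pt i = length (n # length Fs # ?A)"
    using length_concat_take[of i] assms(1) by (simp add: pt_def)
  have "encode_set_cover n Fs t ! (pt i + k) = (?g (Fs ! i) @ ?B) ! k"
    unfolding enc pt using nth_append_length_plus[of "n # length Fs # ?A" "?g (Fs ! i) @ ?B" k]
    by simp
  also have "\<dots> = ?g (Fs ! i) ! k" using assms(2) by (simp add: nth_append del: append_Cons)
  finally show ?thesis
    using assms(2) unfolding inp_nth by (simp add: pt enc)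
qed

lemma inp_len: "i < m \<Longrightarrow> inp (pt i) = length (Fs ! i)"
  using inp_pt[of i 0] by simp

lemma inp_elem: "i < m \<Longrightarrow> k < length (Fs ! i) \<Longrightarrow> inp (pt i + (1 + k)) = Fs ! i ! k"
  using inp_pt[of i "1 + k"] by simp

text \<open>Cells behind the input are 0, which ends the unary number.\<close>

lemma inp_unary: "inp (pt m + k) = of_bool (k < t)"
proof -
  let ?A = "concat (map (\<lambda>S :: nat list. length S # S) Fs)"
  have enc: "encode_set_cover n Fs t = (n # length Fs # ?A) @ replicate t 1"
    unfolding encode_set_cover_def by simp
  have pt: "pt m = length (n # length Fs # ?A)"
    using length_concat_take[of m] by (simp add: pt_def m_def)
  have "encode_set_cover n Fs t ! (pt m + k) = replicate t 1 ! k"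
    unfolding enc pt by (rule nth_append_length_plus)
  then show ?thesis unfolding inp_nth by (simp add: pt enc)
qed

section \<open>Set covers correspond to triangle partitions\<close>

lemma att_element:
  assumes "att g i x" "x < n" "i < h"
  obtains r where "r < q" "q * tok g + r < t" "dig g r < m" "x \<in> set (Fs ! dig g r)"
proof -
  have i: "\<not> i = 0" "\<not> i = 1" "\<not> i = 2" using assms(1,2) unfolding att_def by (auto split: if_splits)
  define r k where "r = (i - 3) div d" and "k = (i - 3) mod d"
  have at: "inp (pt m + (q * tok g + r)) \<noteq> 0" "k < inp (pt (dig g r))"
      "x = inp (pt (dig g r) + (1 + k))"
    using assms(1) i unfolding att_def r_def k_def by auto
  have "i - 3 < q * d" using assms(3) i by (simp add: h_def mult.commute)
  then have r: "r < q" using d_pos unfolding r_def by (simp add: div_less_iff_less_mult)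
  \<comment> \<open>Without sets the universe is empty, so \<open>M\<close> differs from
    \<open>m\<close> only when there is no element at all.\<close>
  have "0 < m"
  proof (rule ccontr)
    assume "\<not> 0 < m"
    then have "F = {}" using set_Fs(2) by auto
    then show False using inst assms(2) unfolding set_cover_instance_def by auto
  qed
  then have dm: "dig g r < m" using dig_less[of g r] by (simp add: M_def)
  then have "k < length (Fs ! dig g r)" "x = Fs ! dig g r ! k"
    using at(2,3) inp_len inp_elem by auto
  then have "x \<in> set (Fs ! dig g r)" by simp
  moreover have "q * tok g + r < t" using at(1) inp_unary by auto
  ultimately show thesis using that r dm by blast
qed

text \<open>A selected gadget and a digit number occupy slot \<open>q * tok g + r\<close>. Slots are
  distinct because tokens are, and only slots below \<open>t\<close> carry elements, so at most
  \<open>t\<close> sets are collected.\<close>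

lemma set_cover_if_triangle_partition:
  assumes "triangle_partition {..<N} E"
  shows "set_cover {..<n} F t"
proof -
  obtain S where S: "S \<subseteq> {..<G}" "inj_on tok S" "\<And>x. x < n \<Longrightarrow> \<exists>g\<in>S. \<exists>i<h. att g i x"
    using triangle_partition_sound[OF assms] by blast
  define D where "D = {(g, r). g \<in> S \<and> r < q \<and> q * tok g + r < t \<and> dig g r < m}"
  let ?C = "(\<lambda>(g, r). set (Fs ! dig g r)) ` D"
  have inj: "inj_on (\<lambda>(g, r). q * tok g + r) D"
  proof (rule inj_onI, clarify)
    fix g r g' r' assume D: "(g, r) \<in> D" "(g', r') \<in> D" and eq: "q * tok g + r = q * tok g' + r'"
    have "r < q" "r' < q" using D unfolding D_def by auto
    then have "tok g = (q * tok g + r) div q" "tok g' = (q * tok g' + r') div q" by auto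
    then have "tok g = tok g'" using eq by simp
    then show "g = g' \<and> r = r'" using eq D S(2) unfolding D_def inj_on_def by auto
  qed
  have "finite S" using S(1) finite_subset by blast
  moreover have "D \<subseteq> S \<times> {..<q}" unfolding D_def by auto
  ultimately have fin: "finite D" by (meson finite_SigmaI finite_lessThan finite_subset)
  have "card ?C \<le> card D" using fin by (rule card_image_le)
  also have "\<dots> = card ((\<lambda>(g, r). q * tok g + r) ` D)" using inj by (simp add: card_image)
  also have "\<dots> \<le> card {..<t}" by (intro card_mono) (auto simp: D_def)
  finally have "card ?C \<le> t" by simp
  moreover have "?C \<subseteq> F" using set_Fs(1) by (auto simp: D_def)
  moreover have "\<Union> ?C = {..<n}"
  proof
    show "\<Union> ?C \<subseteq> {..<n}" using Fs_less by (auto simp: D_def)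
    show "{..<n} \<subseteq> \<Union> ?C"
    proof
      fix x assume "x \<in> {..<n}"
      then have x: "x < n" by simp
      then obtain g i where g: "g \<in> S" "i < h" "att g i x" using S(3) by blast
      then obtain r where "r < q" "q * tok g + r < t" "dig g r < m" "x \<in> set (Fs ! dig g r)"
        using att_element x by blast
      then show "x \<in> \<Union> ?C" using g by (auto simp: D_def)
    qed
  qed
  ultimately show ?thesis unfolding set_cover_def by blast
qed

text \<open>Keeping one set per element bounds the cover by \<open>n\<close> as well as by
  \<open>t\<close>. Hence the chosen sets, numbered from 0, fit into the \<open>q * a\<close> slots
  and into those below \<open>t\<close>.\<close>

lemma triangle_partition_if_set_cover:
  assumes "set_cover {..<n} F t"
  shows "triangle_partition {..<N} E"
proof -
  obtain C where C: "C \<subseteq> F" "card C \<le> t" "\<Union> C = {..<n}"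
    using assms unfolding set_cover_def by blast
  have "F \<subseteq> Pow {..<n}" using inst unfolding set_cover_instance_def by auto
  then have finC: "finite C" using C(1) by (meson finite_Pow_iff finite_lessThan finite_subset)
  have "\<forall>x<n. \<exists>S\<in>C. x \<in> S" using C(3) by blast
  then obtain pick where pick: "\<And>x. x < n \<Longrightarrow> pick x \<in> C \<and> x \<in> pick x" by metis
  define C' where "C' = pick ` {..<n}"
  have C': "C' \<subseteq> C" using pick unfolding C'_def by auto
  have card_n: "card C' \<le> n" using card_image_le[of "{..<n}" pick] unfolding C'_def by simp
  have card_t: "card C' \<le> t" using card_mono[OF finC C'] C(2) by simp
  obtain num where num: "bij_betw num C' {0..<card C'}"
    using ex_bij_betw_finite_nat[of C'] unfolding C'_def by blast
  have num_less: "num (pick x) < card C'" if "x < n" for x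
    using num that unfolding C'_def bij_betw_def by auto
  \<comment> \<open>Slots beyond the cover get an arbitrary valid digit; their ports will absorb
    nothing.\<close>
  have "\<exists>i. i < M \<and> (k < card C' \<longrightarrow> i < m \<and> num (set (Fs ! i)) = k \<and> set (Fs ! i) \<in> C')" for k
  proof (cases "k < card C'")
    case True
    then have "k \<in> num ` C'" using num unfolding bij_betw_def by auto
    then obtain S where S: "S \<in> C'" "num S = k" by auto
    then obtain i where "i < m" "S = set (Fs ! i)" using set_Fs(2) C' C(1) by blast
    then show ?thesis using S by (intro exI[of _ i]) (auto simp: M_def)
  qed (use M_pos in auto)
  then obtain idx where idx: "\<And>k. idx k < M"
    "\<And>k. k < card C' \<Longrightarrow> idx k < m \<and> num (set (Fs ! idx k)) = k \<and> set (Fs ! idx k) \<in> C'"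
    by metis
  have "\<exists>w<M ^ q. \<forall>r<q. w div M ^ r mod M = idx (q * j + r)" for j
    by (rule ex_digits) (rule idx(1))
  then obtain tup where tup: "\<And>j. tup j < M ^ q"
    "\<And>j r. r < q \<Longrightarrow> tup j div M ^ r mod M = idx (q * j + r)" by metis
  define s where "s j = j + a * tup j" for j
  have sel: "s j < G \<and> tok (s j) = j" if "j < a" for j
  proof
    have "a * Suc (tup j) \<le> a * M ^ q" using tup(1)[of j] by (intro mult_left_mono) auto
    then show "s j < G" using that by (simp add: s_def G_def)
    show "tok (s j) = j" using that by (simp add: s_def tok_def)
  qed
  have dig_s: "dig (s j) r = idx (q * j + r)" if "j < a" "r < q" for j r
    using that tup(2) by (simp add: dig_def s_def)
  have elem: "\<exists>k. k < length (Fs ! idx (num (pick x))) \<and> Fs ! idx (num (pick x)) ! k = x" if "x < n" for x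
  proof -
    have "num (set (Fs ! idx (num (pick x)))) = num (pick x)" "set (Fs ! idx (num (pick x))) \<in> C'"
      using idx(2)[OF num_less[OF that]] by auto
    moreover have "pick x \<in> C'" using that unfolding C'_def by auto
    ultimately have "set (Fs ! idx (num (pick x))) = pick x"
      using num unfolding bij_betw_def by (meson inj_onD)
    then show ?thesis using pick[OF that] by (metis in_set_conv_nth)
  qed
  then obtain pos where pos: "\<And>x. x < n \<Longrightarrow> pos x < length (Fs ! idx (num (pick x)))"
    "\<And>x. x < n \<Longrightarrow> Fs ! idx (num (pick x)) ! pos x = x" by metis
  define I where "I x = 3 + ((num (pick x) mod q) * d + pos x)" for x
  show ?thesis
  proof (rule triangle_partition_complete[where s = s and J = "\<lambda>x. num (pick x) div q" and I = I])
    have "3 dvd n + 2 * n mod 3" by presburger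
    then have "3 dvd 3 * a + (n + 2 * n mod 3)" by (intro dvd_add[OF dvd_triv_left])
    then show "3 dvd n + a + y" by (simp add: y_def algebra_simps)
    show "2 * a \<le> y" by (simp add: y_def)
    show "att g 1 (n + a + 2 * tok g)" "att g 2 (n + a + 2 * tok g + 1)" for g
      by (simp_all add: att_def)
    show "j < a \<Longrightarrow> s j < G \<and> tok (s j) = j" for j by (rule sel)
    fix x assume x: "x < n"
    let ?k = "num (pick x)"
    have k: "?k < card C'" by (rule num_less[OF x])
    have im: "idx ?k < m" using idx(2)[OF k] by simp
    have posd: "pos x < d" using pos(1)[OF x] length_Fs[OF im] by simp
    have rq: "?k mod q < q" using q_pos by simp
    have j: "?k div q < a"
      using k card_n div_le_mono[of ?k n q] by (simp add: a_def)
    have "Suc (?k mod q) * d \<le> q * d" using rq by (intro mult_right_mono) auto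
    then have "I x < h" using posd by (simp add: I_def h_def mult.commute)
    moreover have "att (s (?k div q)) (I x) x"
    proof -
      have dv: "(I x - 3) div d = ?k mod q" "(I x - 3) mod d = pos x"
        using posd by (simp_all add: I_def)
      have dg: "dig (s (?k div q)) (?k mod q) = idx ?k"
        using dig_s[OF j rq] by simp
      have un: "q * tok (s (?k div q)) + ?k mod q = ?k" using sel[OF j] by simp
      have "inp (pt m + ?k) \<noteq> 0" using k card_t by (simp add: inp_unary)
      moreover have "I x \<noteq> 0" "I x \<noteq> 1" "I x \<noteq> 2" by (simp_all add: I_def)
      ultimately show ?thesis
        unfolding att_def dv dg un using x pos[OF x] im by (simp add: inp_len inp_elem[simplified])
    qed
    ultimately show "?k div q < a \<and> I x < h \<and> att (s (?k div q)) (I x) x" using j by blast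
  qed
qed

lemma triangle_partition_iff: "triangle_partition {..<N} E \<longleftrightarrow> set_cover {..<n} F t"
  using set_cover_if_triangle_partition triangle_partition_if_set_cover by blast

end

section \<open>Costs of programs\<close>

lemma len_pos: "0 < len x"
  by (simp add: len_def)

lemma len_mono: "x \<le> y \<Longrightarrow> len x \<le> len y"
  by (simp add: len_def floor_log_le_iff)

lemma less_exp_len: "x < 2 ^ len x"
  using floor_log_exp2_gt[of x] by (simp add: len_def)

lemma len_le:
  assumes "x < 2 ^ k" "0 < k"
  shows "len x \<le> k"
proof (cases "x = 0")
  case True
  then show ?thesis using assms by (simp add: len_def)
next
  case False
  then have "2 ^ floor_log x \<le> x" by (simp add: floor_log_exp2_le)
  then have "(2::nat) ^ floor_log x < 2 ^ k" using assms by linarith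
  then show ?thesis by (simp add: len_def)
qed

lemma len_mult: "len (x * y) \<le> len x + len y"
  using less_exp_len[of x] less_exp_len[of y] len_pos[of x]
  by (intro len_le) (auto simp: power_add intro: mult_strict_mono)

lemma len_add: "len (x + y) \<le> len x + len y"
proof (rule len_le)
  obtain i j where ij: "len x = Suc i" "len y = Suc j"
    using len_pos by (metis Suc_pred)
  have "(1::nat) \<le> 2 ^ i" "(1::nat) \<le> 2 ^ j" by simp_all
  then have "2 ^ i + 2 ^ j \<le> 2 * (2 ^ i * (2::nat) ^ j)"
    by (metis add_mono mult_2 mult_le_mono2 mult_le_mono1 nat_mult_1 nat_mult_1_right)
  then have "2 ^ len x + 2 ^ len y \<le> (2::nat) ^ (len x + len y)"
    by (simp add: ij power_add)
  then show "x + y < 2 ^ (len x + len y)"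
    using less_exp_len[of x] less_exp_len[of y] by linarith
qed (use len_pos in auto)

lemma len_le_Suc: "len x \<le> x + 1"
proof (rule len_le)
  show "x < 2 ^ (x + 1)" by (metis add_lessD1 less_exp less_add_one order.strict_trans)
qed simp

text \<open>Bit lengths at most add under all four operations, so the length of a value is at most a
  constant of the expression times the length of the largest cell.\<close>

fun val_weight :: "aexp \<Rightarrow> nat" where
  "val_weight (Const x) = len x"
| "val_weight (Read a e) = 1"
| "val_weight (Binop f e1 e2) = val_weight e1 + val_weight e2"

fun cost_weight :: "aexp \<Rightarrow> nat" where
  "cost_weight (Const x) = len x"
| "cost_weight (Read a e) = cost_weight e + val_weight e + 1"
| "cost_weight (Binop f e1 e2) = cost_weight e1 + cost_weight e2 + val_weight e1 + val_weight e2"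

lemma len_apply_op: "len (apply_op f x y) \<le> len x + len y"
proof (cases f)
  case Minus
  then show ?thesis using len_mono[of "x - y" x] by simp
next
  case Div
  then show ?thesis using len_mono[of "x div y" x] by simp
qed (simp_all add: len_add len_mult)

lemma len_val_le:
  assumes "\<forall>a i. s a i \<le> B"
  shows "len (val e s) \<le> val_weight e * len B"
proof (induction e)
  case (Const x)
  then show ?case using len_pos[of B] by simp
next
  case (Read a e)
  then show ?case using len_mono[of "s a (val e s)" B] assms by simp
next
  case (Binop f e1 e2)
  then show ?case using len_apply_op[of f "val e1 s" "val e2 s"] by (simp add: add_mult_distrib)
qed

lemma cost_le:
  assumes "\<forall>a i. s a i \<le> B"
  shows "cost e s \<le> cost_weight e * len B"
proof (induction e)
  case (Const x)
  then show ?case using len_pos[of B] by simp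
next
  case (Read a e)
  then show ?case
    using assms len_mono[of "s a (val e s)" B] len_val_le[OF assms, of e] by (simp add: add_mult_distrib)
next
  case (Binop f e1 e2)
  then show ?case
    using len_val_le[OF assms, of e1] len_val_le[OF assms, of e2] by (simp add: add_mult_distrib)
qed

lemma cost_len_le:
  assumes "\<forall>a i. s a i \<le> B"
  shows "cost e s + len (val e s) \<le> (cost_weight e + val_weight e) * (B + 1)"
proof -
  have "cost e s + len (val e s) \<le> (cost_weight e + val_weight e) * len B"
    using cost_le[OF assms, of e] len_val_le[OF assms, of e] by (simp add: add_mult_distrib)
  also have "\<dots> \<le> (cost_weight e + val_weight e) * (B + 1)"
    using len_le_Suc by (intro mult_le_mono2)
  finally show ?thesis .
qed

definition runs :: "com \<Rightarrow> mem \<Rightarrow> mem \<Rightarrow> nat \<Rightarrow> bool" where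
  "runs c s s' T \<longleftrightarrow> (\<exists>t\<le>T. exec c s t s')"

lemma runs_Seq: "runs c1 s s1 T1 \<Longrightarrow> runs c2 s1 s2 T2 \<Longrightarrow> runs (Seq c1 c2) s s2 (T1 + T2)"
  unfolding runs_def using exec.Seq add_mono by blast

lemma runs_Write:
  assumes "\<forall>a i. s a i \<le> B"
  shows "runs (Write a e1 e2) s (s(a := (s a)(val e1 s := val e2 s)))
    ((cost_weight e1 + val_weight e1 + cost_weight e2 + val_weight e2) * (B + 1))"
  unfolding runs_def
proof (intro exI conjI)
  show "exec (Write a e1 e2) s (cost e1 s + cost e2 s + len (val e1 s) + len (val e2 s))
      (s(a := (s a)(val e1 s := val e2 s)))" by (rule exec.Write)
  show "cost e1 s + cost e2 s + len (val e1 s) + len (val e2 s) \<le>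
      (cost_weight e1 + val_weight e1 + cost_weight e2 + val_weight e2) * (B + 1)"
    using cost_len_le[OF assms, of e1] cost_len_le[OF assms, of e2] by (simp add: algebra_simps)
qed

lemma runs_While:
  assumes "\<And>i. i < k \<Longrightarrow> runs c (S i) (S (Suc i)) T"
    and "\<And>i. i < k \<Longrightarrow> val e (S i) \<noteq> 0" and "val e (S k) = 0"
    and "\<And>i. i \<le> k \<Longrightarrow> cost e (S i) + len (val e (S i)) \<le> R"
  shows "runs (While e c) (S 0) (S k) (k * (T + R) + R)"
  using assms
proof (induction k arbitrary: S)
  case 0
  then show ?case unfolding runs_def using WhileFalse by fastforce
next
  case (Suc k)
  have "runs (While e c) (S (Suc 0)) (S (Suc k)) (k * (T + R) + R)"
    using Suc.IH[of "\<lambda>i. S (Suc i)"] Suc.prems by auto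
  then obtain t2 where t2: "t2 \<le> k * (T + R) + R" "exec (While e c) (S (Suc 0)) t2 (S (Suc k))"
    unfolding runs_def by blast
  obtain t1 where t1: "t1 \<le> T" "exec c (S 0) t1 (S (Suc 0))"
    using Suc.prems(1)[of 0] unfolding runs_def by blast
  have "exec (While e c) (S 0) (cost e (S 0) + len (val e (S 0)) + t1 + t2) (S (Suc k))"
    using Suc.prems(2)[of 0] t1(2) t2(2) by (intro WhileTrue) auto
  moreover have "cost e (S 0) + len (val e (S 0)) + t1 + t2 \<le> Suc k * (T + R) + R"
    using Suc.prems(4)[of 0] t1(1) t2(1) by simp
  ultimately show ?case unfolding runs_def by blast
qed

section \<open>Running a program on shifted arrays\<close>

primrec shift_aexp :: "nat \<Rightarrow> aexp \<Rightarrow> aexp" where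
  "shift_aexp k (Const x) = Const x"
| "shift_aexp k (Read a e) = Read (a + k) (shift_aexp k e)"
| "shift_aexp k (Binop f e1 e2) = Binop f (shift_aexp k e1) (shift_aexp k e2)"

primrec shift_com :: "nat \<Rightarrow> com \<Rightarrow> com" where
  "shift_com k Skip = Skip"
| "shift_com k (Write a e1 e2) = Write (a + k) (shift_aexp k e1) (shift_aexp k e2)"
| "shift_com k (Seq c1 c2) = Seq (shift_com k c1) (shift_com k c2)"
| "shift_com k (Cond e c1 c2) = Cond (shift_aexp k e) (shift_com k c1) (shift_com k c2)"
| "shift_com k (While e c) = While (shift_aexp k e) (shift_com k c)"

lemma val_shift: "(\<And>a. r (a + k) = s a) \<Longrightarrow> val (shift_aexp k e) r = val e s"
  by (induction e) simp_all

lemma cost_shift: "(\<And>a. r (a + k) = s a) \<Longrightarrow> cost (shift_aexp k e) r = cost e s"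
  by (induction e) (simp_all add: val_shift)

text \<open>Costs depend on indices and values but not on array names, so the shifted program takes
  exactly the same time, whatever the lower arrays contain.\<close>

lemma exec_shift:
  assumes "exec c s t s'" "\<And>a. r (a + k) = s a"
  shows "\<exists>r'. exec (shift_com k c) r t r' \<and> (\<forall>a. r' (a + k) = s' a)"
  using assms
proof (induction arbitrary: r rule: exec.induct)
  case (Skip s)
  then show ?case using exec.Skip by auto
next
  case (Write a e1 e2 s)
  note eqs = val_shift[of r k s, OF Write] cost_shift[of r k s, OF Write]
  have "exec (shift_com k (Write a e1 e2)) r
      (cost e1 s + cost e2 s + len (val e1 s) + len (val e2 s))
      (r(a + k := (r (a + k))(val e1 s := val e2 s)))"
    using exec.Write[of "a + k" "shift_aexp k e1" "shift_aexp k e2" r] by (simp add: eqs)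
  then show ?case using Write by (intro exI conjI) (assumption, auto)
next
  case (Seq c1 s t1 s1 c2 t2 s2)
  obtain r1 where r1: "exec (shift_com k c1) r t1 r1" "\<And>a. r1 (a + k) = s1 a"
    using Seq.IH(1)[OF Seq.prems] by blast
  obtain r2 where "exec (shift_com k c2) r1 t2 r2" "\<forall>a. r2 (a + k) = s2 a"
    using Seq.IH(2)[OF r1(2)] by blast
  then show ?case using r1(1) exec.Seq by (metis shift_com.simps(3))
next
  case (CondTrue e s c1 t s1 c2)
  note eqs = val_shift[of r k s, OF CondTrue.prems] cost_shift[of r k s, OF CondTrue.prems]
  obtain r1 where "exec (shift_com k c1) r t r1" "\<forall>a. r1 (a + k) = s1 a"
    using CondTrue.IH[OF CondTrue.prems] by blast
  moreover from this have "exec (shift_com k (Cond e c1 c2)) r (cost e s + len (val e s) + t) r1"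
    using exec.CondTrue[of "shift_aexp k e" r "shift_com k c1" t r1 "shift_com k c2"] CondTrue.hyps by (simp add: eqs)
  ultimately show ?case by blast
next
  case (CondFalse e s c2 t s2 c1)
  note eqs = val_shift[of r k s, OF CondFalse.prems] cost_shift[of r k s, OF CondFalse.prems]
  obtain r2 where "exec (shift_com k c2) r t r2" "\<forall>a. r2 (a + k) = s2 a"
    using CondFalse.IH[OF CondFalse.prems] by blast
  moreover from this have "exec (shift_com k (Cond e c1 c2)) r (cost e s + len (val e s) + t) r2"
    using exec.CondFalse[of "shift_aexp k e" r "shift_com k c2" t r2 "shift_com k c1"] CondFalse.hyps by (simp add: eqs)
  ultimately show ?case by blast
next
  case (WhileFalse e s c)
  note eqs = val_shift[of r k s, OF WhileFalse.prems] cost_shift[of r k s, OF WhileFalse.prems]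
  show ?case
    using exec.WhileFalse[of "shift_aexp k e" r] WhileFalse by (auto simp: eqs)
next
  case (WhileTrue e s c t1 s1 t2 s2)
  note eqs = val_shift[of r k s, OF WhileTrue.prems] cost_shift[of r k s, OF WhileTrue.prems]
  obtain r1 where r1: "exec (shift_com k c) r t1 r1" "\<And>a. r1 (a + k) = s1 a"
    using WhileTrue.IH(1)[OF WhileTrue.prems] by blast
  obtain r2 where r2: "exec (shift_com k (While e c)) r1 t2 r2" "\<forall>a. r2 (a + k) = s2 a"
    using WhileTrue.IH(2)[OF r1(2)] by blast
  have "exec (shift_com k (While e c)) r (cost e s + len (val e s) + t1 + t2) r2"
    using exec.WhileTrue[of "shift_aexp k e" r "shift_com k c" t1 r1 t2 r2] r1(1) r2(1) WhileTrue.hyps(1)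
    by (simp add: eqs)
  then show ?case using r2(2) by blast
qed

section \<open>The reduction as a program\<close>

abbreviation "addE \<equiv> Binop Plus"
abbreviation "subE \<equiv> Binop Minus"
abbreviation "mulE \<equiv> Binop Times"
abbreviation "divE \<equiv> Binop Div"

text \<open>Truth values are 0 and 1: truncated subtraction from 1 negates, and truncated
  differences compare.\<close>

definition "notE e = subE (Const 1) e"
definition "nzE e = notE (notE e)"
definition "eqE x y = notE (addE (subE x y) (subE y x))"
definition "ltE x y = nzE (subE y x)"
definition "modE x y = subE x (mulE (divE x y) y)"
definition "orE es = nzE (foldr addE es (Const 0))"

primrec powE :: "aexp \<Rightarrow> nat \<Rightarrow> aexp" where
  "powE e 0 = Const 1"
| "powE e (Suc k) = mulE e (powE e k)"

lemma val_notE [simp]: "val (notE e) s = of_bool (val e s = 0)"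
  by (simp add: notE_def)

lemma val_nzE [simp]: "val (nzE e) s = of_bool (val e s \<noteq> 0)"
  by (simp add: nzE_def)

lemma val_eqE [simp]: "val (eqE x y) s = of_bool (val x s = val y s)"
  by (auto simp: eqE_def)

lemma val_ltE [simp]: "val (ltE x y) s = of_bool (val x s < val y s)"
  by (simp add: ltE_def)

lemma val_modE [simp]: "val (modE x y) s = val x s mod val y s"
  by (simp add: modE_def minus_div_mult_eq_mod)

lemma val_orE [simp]: "val (orE es) s = of_bool (\<exists>e\<in>set es. val e s \<noteq> 0)"
proof -
  have "val (foldr addE es (Const 0)) s \<noteq> 0 \<longleftrightarrow> (\<exists>e\<in>set es. val e s \<noteq> 0)"
    by (induction es) auto
  then show ?thesis by (simp add: orE_def)
qed

lemma val_powE [simp]: "val (powE e k) s = val e s ^ k"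
  by (induction k) simp_all

definition "nE = Read 0 (Const 0)"
definition "mE = Read 0 (Const 1)"
definition "ME = addE mE (notE mE)"
definition "aE q = addE (divE nE (Const q)) (Const 1)"
definition "CE q = addE nE (aE q)"
definition "HE q = addE (CE q) (addE (mulE (Const 2) (aE q)) (modE (mulE (Const 2) nE) (Const 3)))"
definition "NE d q = addE (HE q) (mulE (mulE (aE q) (powE ME q)) (Const (12 * (d * q + 3))))"
definition "tokE q g = modE g (aE q)"
definition "setE q g r = Read 1 (modE (divE (divE g (aE q)) (powE ME r)) ME)"
definition "attE d q g i x =
  (if i = 0 then eqE x (addE nE (tokE q g))
   else if i = 1 then eqE x (addE (CE q) (mulE (Const 2) (tokE q g)))
   else if i = 2 then eqE x (addE (addE (CE q) (mulE (Const 2) (tokE q g))) (Const 1))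
   else mulE (ltE x nE)
     (mulE (nzE (Read 0 (addE (Read 1 mE) (addE (mulE (Const q) (tokE q g)) (Const ((i - 3) div d))))))
     (mulE (ltE (Const ((i - 3) mod d)) (Read 0 (setE q g ((i - 3) div d))))
       (eqE x (Read 0 (addE (setE q g ((i - 3) div d)) (Const (1 + (i - 3) mod d))))))))"
definition "touchesE d q g l x =
  orE (map (\<lambda>i. mulE (attE d q g i x) (addE (eqE l (Const (6 * i))) (eqE l (Const (6 * i + 1)))))
    [0..<d * q + 3])"
text \<open>As \<open>h\<close> is a constant, gadget adjacency is compiled into a finite table of
  pairs.\<close>

definition "gadget_adjE h l l' =
  orE (map (\<lambda>(k, k'). mulE (eqE l (Const k)) (eqE l' (Const k')))
    (filter (\<lambda>(k, k'). gadget_adj h k k') (List.product [0..<12 * h] [0..<12 * h])))"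
definition "blockE d q u = divE (subE u (HE q)) (Const (12 * (d * q + 3)))"
definition "localE d q u = modE (subE u (HE q)) (Const (12 * (d * q + 3)))"
text \<open>Branching inside an expression; both branches are evaluated, which is harmless for
  expressions of fixed size.\<close>

definition "ifE b x y = addE (mulE b x) (mulE (notE b) y)"
definition "adjE d q u v =
  ifE (ltE u (HE q))
    (ifE (ltE v (HE q))
      (mulE (notE (ltE u (CE q))) (mulE (notE (ltE v (CE q))) (notE (eqE u v))))
      (touchesE d q (blockE d q v) (localE d q v) u))
    (ifE (ltE v (HE q))
      (touchesE d q (blockE d q u) (localE d q u) v)
      (mulE (eqE (blockE d q u) (blockE d q v))
        (gadget_adjE (d * q + 3) (localE d q u) (localE d q v))))"
definition "outE d q i =
  ifE (eqE i (Const 0)) (NE d q)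
    (ifE (ltE (subE i (Const 1)) (mulE (NE d q) (NE d q)))
      (adjE d q (divE (subE i (Const 1)) (NE d q)) (modE (subE i (Const 1)) (NE d q)))
      (ltE (subE (subE i (Const 1)) (mulE (NE d q) (NE d q))) (HE q)))"

text \<open>Array 0 holds the input, array 1 the positions of the sets, array 2 the two loop counters; the
  arrays of the given program are shifted by 3, so that array 3 receives the graph.\<close>

definition "cell k = Read 2 (Const k)"
definition "parse_body = Seq
  (Write 1 (addE (cell 0) (Const 1))
    (addE (Read 1 (cell 0)) (addE (Const 1) (Read 0 (Read 1 (cell 0))))))
  (Write 2 (Const 0) (addE (cell 0) (Const 1)))"
definition "parse_cond = subE mE (cell 0)"
definition "matrix_body d q = Seq
  (Write 3 (cell 1) (outE d q (cell 1)))
  (Write 2 (Const 1) (addE (cell 1) (Const 1)))"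
definition "matrix_cond d q =
  subE (addE (Const 1) (addE (mulE (NE d q) (NE d q)) (NE d q))) (cell 1)"
text \<open>The first set is stored behind \<open>n\<close> and the number of sets, hence the
  initial pointer 2.\<close>

definition "build_graph d q = Seq (Write 1 (Const 0) (Const 2))
  (Seq (While parse_cond parse_body) (While (matrix_cond d q) (matrix_body d q)))"
definition "set_cover_prog d q c = Seq (build_graph d q)
  (Seq (shift_com 3 c) (Write 0 (Const 0) (Read 3 (Const 0))))"

section \<open>Values of the expressions\<close>

lemma val_ifE [simp]:
  "val b s = of_bool p \<Longrightarrow> val (ifE b x y) s = (if p then val x s else val y s)"
  by (simp add: ifE_def)

lemma concat_rows:
  "concat (map (\<lambda>u. map (f u) [0..<N]) [0..<k]) = map (\<lambda>i. f (i div N) (i mod N)) [0..<k * N]"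
proof (induction k)
  case (Suc k)
  have "[0..<Suc k * N] = [0..<k * N] @ map (\<lambda>j. k * N + j) [0..<N]"
    using upt_add_eq_append[of 0 "k * N" N] by (simp add: map_add_upt add.commute)
  moreover have "map (\<lambda>j. f ((k * N + j) div N) ((k * N + j) mod N)) [0..<N] = map (f k) [0..<N]"
    by (rule map_cong) auto
  ultimately show ?case using Suc by (simp add: comp_def)
qed simp

lemma length_encode_graph_hub: "length (encode_graph_hub N E Q) = 1 + (N * N + N)"
  unfolding encode_graph_hub_def concat_rows by simp

lemma encode_graph_hub_nth:
  assumes "i < 1 + (N * N + N)"
  shows "encode_graph_hub N E Q ! i =
    (if i = 0 then N else if i - 1 < N * N then of_bool (((i - 1) div N, (i - 1) mod N) \<in> E)
     else of_bool (i - 1 - N * N \<in> Q))"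
  using assms unfolding encode_graph_hub_def concat_rows
  by (auto simp: nth_append nth_Cons')

context reduction begin

context
  fixes s :: mem assumes input: "s 0 = inp" and ptrs: "\<And>i. i \<le> m \<Longrightarrow> s 1 i = pt i"
begin

lemma val_nE: "val nE s = n" by (simp add: nE_def input inp_0)
lemma val_mE: "val mE s = m" using inp_1 by (simp add: mE_def input)
lemma val_ME: "val ME s = M" by (simp add: ME_def val_mE M_def)
lemma val_aE: "val (aE q) s = a" by (simp add: aE_def val_nE a_def)
lemma val_CE: "val (CE q) s = n + a" by (simp add: CE_def val_nE val_aE)
lemma val_HE: "val (HE q) s = H"
  unfolding H_def unfolding y_def by (simp add: HE_def val_nE val_aE val_CE)
lemma val_NE: "val (NE d q) s = N"
  unfolding N_def unfolding G_def h_def by (simp add: NE_def val_HE val_aE val_ME)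
lemma val_tokE: "val (tokE q g) s = tok (val g s)" by (simp add: tokE_def val_aE tok_def)

lemma val_setE: "val (setE q g r) s = pt (dig (val g s) r)"
  using ptrs[OF dig_le[of "val g s" r]] by (simp add: setE_def val_aE val_ME dig_def)

lemma val_attE: "val (attE d q g i x) s = of_bool (att (val g s) i (val x s))"
  using ptrs[of m]
  by (simp add: attE_def att_def val_nE val_mE val_CE val_tokE val_setE input flip: of_bool_conj)

lemma val_touchesE:
  "val (touchesE d q g l x) s = of_bool (touches h att (val g s) (val l s) (val x s))"
  unfolding touchesE_def touches_def val_orE by (auto simp: val_attE h_def)

lemma val_gadget_adjE:
  "val (gadget_adjE h l l') s = of_bool (gadget_adj h (val l s) (val l' s))"
  unfolding gadget_adjE_def val_orE using gadget_adj_less by (auto simp: split_beta)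

lemma val_blockE: "val (blockE d q u) s = (val u s - H) div (12 * h)"
  by (simp add: blockE_def val_HE h_def)

lemma val_localE: "val (localE d q u) s = (val u s - H) mod (12 * h)"
  by (simp add: localE_def val_HE h_def)

lemma val_adjE:
  "val (adjE d q u v) s = of_bool (hub_adj h (n + a) H att (val u s) (val v s))"
  unfolding adjE_def hub_adj_def h_def[symmetric]
  by (auto simp: val_HE val_CE val_touchesE val_gadget_adjE val_blockE val_localE not_less)

lemma val_outE:
  assumes "val i s < 1 + (N * N + N)"
  shows "val (outE d q i) s = encode_graph_hub N E {..<H} ! val i s"
proof -
  \<comment> \<open>\<open>E\<close> demands vertices below \<open>N\<close>; quotient and remainder
    of an index below \<open>N * N\<close> satisfy this.\<close>
  have "(k div N, k mod N) \<in> E \<longleftrightarrow> hub_adj h (n + a) H att (k div N) (k mod N)" if "k < N * N" for k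
  proof -
    have "0 < N" using that by (auto intro: gr0I)
    then have "k div N < N" "k mod N < N" using that by (simp_all add: div_less_iff_less_mult)
    then show ?thesis by (simp add: E_def)
  qed
  then show ?thesis
    unfolding encode_graph_hub_nth[OF assms] outE_def by (simp add: val_NE val_HE val_adjE)
qed

end

end

section \<open>Running time of the reduction\<close>

definition "weight e = cost_weight e + val_weight e"

text \<open>The constant of the quadratic time bound: the initial write and the two loops, with each
  loop condition counted twice as in \<open>loop_time_le\<close>.\<close>

definition "build_weight d q =
  weight (Const 0) + weight (Const 2)
  + (weight (addE (cell 0) (Const 1))
    + weight (addE (Read 1 (cell 0)) (addE (Const 1) (Read 0 (Read 1 (cell 0)))))
    + (weight (Const 0) + weight (addE (cell 0) (Const 1))) + 2 * weight parse_cond)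
  + (weight (cell 1) + weight (outE d q (cell 1))
    + (weight (Const 1) + weight (addE (cell 1) (Const 1))) + 2 * weight (matrix_cond d q))"

lemma runs_mono: "runs c s s' T \<Longrightarrow> T \<le> T' \<Longrightarrow> runs c s s' T'"
  unfolding runs_def using order_trans by blast

lemma runs_Write_weight:
  assumes "\<forall>a i. s a i \<le> B" "s' = s(a := (s a)(val e1 s := val e2 s))"
  shows "runs (Write a e1 e2) s s' ((weight e1 + weight e2) * (B + 1))"
  using runs_Write[OF assms(1), of a e1 e2] assms(2) by (simp add: weight_def add.assoc)

text \<open>Simplifies the bound of \<open>runs_While\<close>: the condition is evaluated once more
  than the body, which the second \<open>c\<close> pays for.\<close>

lemma loop_time_le:
  fixes k X b c :: nat
  assumes "k \<le> X" "1 \<le> X"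
  shows "k * (b * X + c * X) + c * X \<le> (b + 2 * c) * X\<^sup>2"
proof -
  have "k * (b * X + c * X) \<le> X * (b * X + c * X)" using assms by (intro mult_right_mono) auto
  moreover have "c * X \<le> c * X * X" using assms by simp
  moreover have "(b + 2 * c) * X\<^sup>2 = X * (b * X + c * X) + c * X * X"
    by (simp add: power2_eq_square algebra_simps)
  ultimately show ?thesis by linarith
qed

context reduction begin

definition "graph_code = encode_graph_hub N E {..<H}"
definition "L = 1 + (N * N + N)"
text \<open>One bound for all that a cell holds while the graph is built: input entries, pointers,
  counters and the graph code. It also bounds the number of rounds of both loops.\<close>

definition "B = n + m * (d + 2) + d + 3 + N + L"

text \<open>The invariant of both loops: \<open>k\<close> sets parsed, \<open>j\<close> entries of
  the graph written. Pointer 0 is present from the start, hence \<open>l \<le> k\<close>.\<close>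

definition state :: "nat \<Rightarrow> nat \<Rightarrow> mem" where
  "state k j = (\<lambda>a.
     if a = 0 then inp
     else if a = 1 then (\<lambda>l. if l \<le> k then pt l else 0)
     else if a = 2 then (\<lambda>l. if l = 0 then k else if l = 1 then j else 0)
     else if a = 3 then (\<lambda>l. if l < j then graph_code ! l else 0)
     else (\<lambda>l. 0))"

lemma length_graph_code: "length graph_code = L"
  by (simp add: graph_code_def L_def length_encode_graph_hub)

lemma graph_code_le: "l < L \<Longrightarrow> graph_code ! l \<le> N + 1"
  unfolding graph_code_def L_def by (subst encode_graph_hub_nth) auto

lemma inp_le: "inp i \<le> n + m + d + 1"
proof -
  have "x \<le> n + m + d + 1" if x: "x \<in> set (encode_set_cover n Fs t)" for x
  proof -
    consider "x = n" | "x = m" | "x = 1" | i where "i < m" "x = length (Fs ! i)"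
      | i where "i < m" "x \<in> set (Fs ! i)"
      using x unfolding encode_set_cover_def m_def
      by (auto simp: in_set_conv_nth[of _ Fs] split: if_splits)
    then show ?thesis using length_Fs Fs_less by cases fastforce+
  qed
  then show ?thesis unfolding inp_nth by auto
qed

lemma pt_le: "i \<le> m \<Longrightarrow> pt i \<le> 2 + m * (d + 1)"
proof -
  assume i: "i \<le> m"
  have "(\<Sum>l<i. 1 + length (Fs ! l)) \<le> (\<Sum>l<i. d + 1)"
    using i length_Fs by (intro sum_mono) (simp add: add.commute)
  also have "\<dots> = i * (d + 1)" by simp
  also have "\<dots> \<le> m * (d + 1)" using i by (intro mult_right_mono) auto
  finally show ?thesis by (simp add: pt_def)
qed

lemma state_le:
  assumes "k \<le> m" "j \<le> L"
  shows "\<forall>a i. state k j a i \<le> B"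
proof (intro allI)
  fix a i
  have "inp i \<le> B" using inp_le[of i] by (simp add: B_def algebra_simps)
  moreover have "pt i \<le> B" if "i \<le> k" using pt_le[of i] that assms(1) by (simp add: B_def algebra_simps)
  moreover have "graph_code ! i \<le> B" if "i < j"
    using graph_code_le[of i] that assms(2) by (simp add: B_def)
  moreover have "k \<le> B" "j \<le> B" using assms by (simp_all add: B_def algebra_simps)
  ultimately show "state k j a i \<le> B" by (cases "a = 3") (simp_all add: state_def)
qed

lemma runs_parse_body:
  assumes "k < m"
  shows "runs parse_body (state k 0) (state (Suc k) 0)
    ((weight (addE (cell 0) (Const 1))
      + weight (addE (Read 1 (cell 0)) (addE (Const 1) (Read 0 (Read 1 (cell 0)))))
      + (weight (Const 0) + weight (addE (cell 0) (Const 1)))) * (B + 1))"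
proof -
  define s where "s = (state k 0)(1 := state (Suc k) 0 1)"
  have bnd: "\<forall>a i. state k 0 a i \<le> B" "\<forall>a i. state (Suc k) 0 a i \<le> B"
    using assms by (simp_all add: state_le)
  then have s: "\<forall>a i. s a i \<le> B" by (simp add: s_def)
  have 1: "runs (Write 1 (addE (cell 0) (Const 1))
      (addE (Read 1 (cell 0)) (addE (Const 1) (Read 0 (Read 1 (cell 0)))))) (state k 0) s
      ((weight (addE (cell 0) (Const 1)) +
        weight (addE (Read 1 (cell 0)) (addE (Const 1) (Read 0 (Read 1 (cell 0)))))) * (B + 1))"
    using assms inp_len[OF assms]
    by (intro runs_Write_weight bnd) (auto simp: s_def state_def cell_def pt_def fun_eq_iff le_Suc_eq)
  have 2: "runs (Write 2 (Const 0) (addE (cell 0) (Const 1))) s (state (Suc k) 0)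
      ((weight (Const 0) + weight (addE (cell 0) (Const 1))) * (B + 1))"
    by (intro runs_Write_weight s) (auto simp: s_def state_def cell_def fun_eq_iff)
  show ?thesis
    unfolding parse_body_def by (rule runs_mono[OF runs_Seq[OF 1 2]]) (simp only: add_mult_distrib[symmetric] order_refl)
qed

lemma runs_parse:
  "runs (While parse_cond parse_body) (state 0 0) (state m 0)
    ((weight (addE (cell 0) (Const 1))
      + weight (addE (Read 1 (cell 0)) (addE (Const 1) (Read 0 (Read 1 (cell 0)))))
      + (weight (Const 0) + weight (addE (cell 0) (Const 1))) + 2 * weight parse_cond) * (B + 1)\<^sup>2)"
proof -
  have v: "val parse_cond (state k 0) = m - k" for k
    using inp_1 by (simp add: parse_cond_def mE_def cell_def state_def)
  show ?thesis
  proof (rule runs_mono[OF runs_While[of m parse_body "\<lambda>k. state k 0", OF runs_parse_body, where e = parse_cond and R = "weight parse_cond * (B + 1)"] loop_time_le])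
    show "k \<le> m \<Longrightarrow> cost parse_cond (state k 0) + len (val parse_cond (state k 0)) \<le> weight parse_cond * (B + 1)" for k
      unfolding weight_def by (intro cost_len_le state_le) auto
    show "m \<le> B + 1" by (simp add: B_def algebra_simps)
  qed (auto simp: v)
qed

lemma runs_matrix_body:
  assumes "j < L"
  shows "runs (matrix_body d q) (state m j) (state m (Suc j))
    ((weight (cell 1) + weight (outE d q (cell 1))
      + (weight (Const 1) + weight (addE (cell 1) (Const 1)))) * (B + 1))"
proof -
  define s where "s = (state m j)(3 := state m (Suc j) 3)"
  have bnd: "\<forall>a i. state m j a i \<le> B" "\<forall>a i. state m (Suc j) a i \<le> B"
    using assms by (simp_all add: state_le)
  then have s: "\<forall>a i. s a i \<le> B" by (simp add: s_def)
  have out: "val (outE d q (cell 1)) (state m j) = graph_code ! j"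
    using assms val_outE[of "state m j" "cell 1"]
    by (simp add: state_def cell_def graph_code_def L_def)
  have 1: "runs (Write 3 (cell 1) (outE d q (cell 1))) (state m j) s
      ((weight (cell 1) + weight (outE d q (cell 1))) * (B + 1))"
    by (intro runs_Write_weight bnd, unfold out)
      (auto simp: s_def state_def cell_def fun_eq_iff less_Suc_eq)
  have 2: "runs (Write 2 (Const 1) (addE (cell 1) (Const 1))) s (state m (Suc j))
      ((weight (Const 1) + weight (addE (cell 1) (Const 1))) * (B + 1))"
    by (intro runs_Write_weight s) (auto simp: s_def state_def cell_def fun_eq_iff)
  show ?thesis
    unfolding matrix_body_def by (rule runs_mono[OF runs_Seq[OF 1 2]]) (simp only: add_mult_distrib[symmetric] order_refl)
qed

lemma runs_matrix:
  "runs (While (matrix_cond d q) (matrix_body d q)) (state m 0) (state m L)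
    ((weight (cell 1) + weight (outE d q (cell 1))
      + (weight (Const 1) + weight (addE (cell 1) (Const 1))) + 2 * weight (matrix_cond d q)) * (B + 1)\<^sup>2)"
proof -
  have v: "val (matrix_cond d q) (state m j) = L - j" for j
    using val_NE[of "state m j"] by (simp add: matrix_cond_def cell_def state_def L_def)
  show ?thesis
  proof (rule runs_mono[OF runs_While[of L "matrix_body d q" "state m", OF runs_matrix_body, where e = "matrix_cond d q" and R = "weight (matrix_cond d q) * (B + 1)"] loop_time_le])
    show "j \<le> L \<Longrightarrow> cost (matrix_cond d q) (state m j) + len (val (matrix_cond d q) (state m j))
        \<le> weight (matrix_cond d q) * (B + 1)" for j
      unfolding weight_def by (intro cost_len_le state_le) auto
    show "L \<le> B + 1" by (simp add: B_def)
  qed (auto simp: v)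
qed

lemma runs_build_graph:
  "runs (build_graph d q) (input_mem (encode_set_cover n Fs t)) (state m L)
    (build_weight d q * (B + 1)\<^sup>2)"
proof -
  have "inp i \<le> B" for i using inp_le[of i] by (simp add: B_def algebra_simps)
  moreover have "input_mem (encode_set_cover n Fs t) a i = (if a = 0 then inp i else 0)" for a i
    by (simp add: inp_def input_mem_def)
  ultimately have bnd: "\<forall>a i. input_mem (encode_set_cover n Fs t) a i \<le> B" by simp
  have "runs (Write 1 (Const 0) (Const 2)) (input_mem (encode_set_cover n Fs t)) (state 0 0)
      ((weight (Const 0) + weight (Const 2)) * (B + 1))"
    by (intro runs_Write_weight bnd) (auto simp: state_def inp_def input_mem_def pt_def fun_eq_iff)
  then have 0: "runs (Write 1 (Const 0) (Const 2)) (input_mem (encode_set_cover n Fs t)) (state 0 0)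
      ((weight (Const 0) + weight (Const 2)) * (B + 1)\<^sup>2)"
    by (rule runs_mono) (simp add: power2_eq_square)
  show ?thesis
    unfolding build_graph_def build_weight_def
    by (rule runs_mono[OF runs_Seq[OF 0 runs_Seq[OF runs_parse runs_matrix]]])
      (simp only: add_mult_distrib[symmetric] add.assoc order_refl)
qed

lemma set_cover_prog_decides:
  assumes "decides_within c (encode_graph_hub N E {..<H}) (triangle_partition {..<N} E) T"
  shows "decides_within (set_cover_prog d q c) (encode_set_cover n Fs t) (set_cover {..<n} F t)
    (real (build_weight d q * (B + 1)\<^sup>2 + 6) + T)"
proof -
  obtain t1 where t1: "t1 \<le> build_weight d q * (B + 1)\<^sup>2"
    "exec (build_graph d q) (input_mem (encode_set_cover n Fs t)) t1 (state m L)"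
    using runs_build_graph unfolding runs_def by blast
  obtain t2 s where t2: "exec c (input_mem (encode_graph_hub N E {..<H})) t2 s"
    "s 0 0 = of_bool (triangle_partition {..<N} E)" "real t2 \<le> T"
    using assms unfolding decides_within_def by blast
  \<comment> \<open>From array 3 on, the memory is exactly the initial memory that \<open>c\<close>
    expects, so \<open>exec_shift\<close> applies to its run.\<close>
  have "state m L (b + 3) = input_mem (encode_graph_hub N E {..<H}) b" for b
    unfolding graph_code_def[symmetric]
    by (auto simp: state_def input_mem_def length_graph_code fun_eq_iff)
  then obtain r where r: "exec (shift_com 3 c) (state m L) t2 r" "\<And>b. r (b + 3) = s b"
    using exec_shift[OF t2(1)] by blast
  have r30: "r 3 0 = of_bool (set_cover {..<n} F t)"
    using r(2)[of 0] t2(2) triangle_partition_iff by simp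
  let ?w = "Write 0 (Const 0) (Read 3 (Const 0))"
  have "exec ?w r (cost (Const 0) r + cost (Read 3 (Const 0)) r + len (val (Const 0) r)
      + len (val (Read 3 (Const 0)) r)) (r(0 := (r 0)(val (Const 0) r := val (Read 3 (Const 0)) r)))"
    by (rule exec.Write)
  moreover have "len (r 3 0) = 1" unfolding r30 by (simp add: len_def)
  \<comment> \<open>All six numbers that are charged for have one digit.\<close>
  ultimately have w: "exec ?w r 6 (r(0 := (r 0)(0 := r 3 0)))"
    by (simp add: len_def[of 0] numeral_eq_Suc)
  have "exec (set_cover_prog d q c) (input_mem (encode_set_cover n Fs t)) (t1 + (t2 + 6))
      (r(0 := (r 0)(0 := r 3 0)))"
    unfolding set_cover_prog_def using t1(2) r(1) w by (intro exec.Seq)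
  moreover have "real (t1 + (t2 + 6)) \<le> real (build_weight d q * (B + 1)\<^sup>2 + 6) + T"
    using t1(1) t2(3) by (simp flip: of_nat_add of_nat_mult of_nat_power)
  ultimately show ?thesis
    unfolding decides_within_def using r30 by (intro exI conjI) (assumption, auto)
qed

end

section \<open>Polynomial bounds\<close>

text \<open>The form \<open>(n + 1) ^ e\<close> behaves well under sums and products without an
  exception at \<open>n = 0\<close>.\<close>

definition poly_bounded :: "(nat \<Rightarrow> nat) \<Rightarrow> bool" where
  "poly_bounded f \<longleftrightarrow> (\<exists>C e. \<forall>n. f n \<le> C * (n + 1) ^ e)"

lemma poly_bounded_const: "poly_bounded (\<lambda>n. c)"
  unfolding poly_bounded_def by (intro exI[of _ c] exI[of _ 0]) simp

lemma poly_bounded_id: "poly_bounded (\<lambda>n. n)"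
  unfolding poly_bounded_def by (intro exI[of _ 1]) simp

lemma poly_bounded_add:
  assumes "poly_bounded f" "poly_bounded g"
  shows "poly_bounded (\<lambda>n. f n + g n)"
proof -
  obtain C e D k where f: "\<And>n. f n \<le> C * (n + 1) ^ e" and g: "\<And>n. g n \<le> D * (n + 1) ^ k"
    using assms unfolding poly_bounded_def by blast
  have "f n + g n \<le> (C + D) * (n + 1) ^ (e + k)" for n
  proof -
    have "C * (n + 1) ^ e \<le> C * (n + 1) ^ (e + k)" "D * (n + 1) ^ k \<le> D * (n + 1) ^ (e + k)"
      by (intro mult_le_mono2 power_increasing; simp)+
    then show ?thesis using f[of n] g[of n] unfolding add_mult_distrib by linarith
  qed
  then show ?thesis unfolding poly_bounded_def by blast
qed

lemma poly_bounded_mult: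
  assumes "poly_bounded f" "poly_bounded g"
  shows "poly_bounded (\<lambda>n. f n * g n)"
proof -
  obtain C e D k where f: "\<And>n. f n \<le> C * (n + 1) ^ e" and g: "\<And>n. g n \<le> D * (n + 1) ^ k"
    using assms unfolding poly_bounded_def by blast
  have "f n * g n \<le> (C * D) * (n + 1) ^ (e + k)" for n
    using mult_le_mono[OF f[of n] g[of n]] by (simp add: power_add algebra_simps)
  then show ?thesis unfolding poly_bounded_def by blast
qed

lemma poly_bounded_power:
  assumes "poly_bounded f"
  shows "poly_bounded (\<lambda>n. f n ^ k)"
  by (induction k) (simp_all add: poly_bounded_const poly_bounded_mult assms)

lemma poly_boundedE:
  assumes "poly_bounded f"
  obtains k where "\<And>n. f n \<le> k * n ^ k + k"
proof -
  obtain C e where f: "\<And>n. f n \<le> C * (n + 1) ^ e"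
    using assms unfolding poly_bounded_def by blast
  \<comment> \<open>One number serves as coefficient, exponent and additive term;
    \<open>2 ^ e\<close> comes from \<open>n + 1 \<le> 2 * n\<close> for positive
    \<open>n\<close>.\<close>
  define k where "k = C * 2 ^ e + e"
  have "f n \<le> k * n ^ k + k" for n
  proof (cases "n = 0")
    case True
    have "C * 1 \<le> C * 2 ^ e" by (intro mult_le_mono2) simp
    moreover have "f 0 \<le> C * 1" using f[of 0] by simp
    ultimately have "f 0 \<le> k" unfolding k_def by linarith
    then show ?thesis using True by (simp add: trans_le_add2)
  next
    case False
    have "(n + 1) ^ e \<le> (2 * n) ^ e" using False by (intro power_mono) auto
    then have "C * (n + 1) ^ e \<le> C * 2 ^ e * n ^ e" by (simp add: power_mult_distrib)
    also have "\<dots> \<le> k * n ^ k" using False by (intro mult_le_mono power_increasing) (auto simp: k_def)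
    finally show ?thesis using f[of n] by simp
  qed
  then show thesis by (rule that)
qed

text \<open>Lists of length \<open>d\<close> over \<open>{..n}\<close> represent all these sets:
  enumerate the set and fill up with \<open>n\<close>, which lies outside
  \<open>{..<n}\<close>.\<close>

lemma card_bounded_subsets_le: "card {S. S \<subseteq> {..<n} \<and> card S \<le> d} \<le> (n + 1) ^ d"
proof -
  have "{S. S \<subseteq> {..<n} \<and> card S \<le> d} \<subseteq>
    (\<lambda>xs. set xs \<inter> {..<n}) ` {xs. set xs \<subseteq> {..n} \<and> length xs = d}"
  proof
    fix S assume "S \<in> {S. S \<subseteq> {..<n} \<and> card S \<le> d}"
    then have S: "S \<subseteq> {..<n}" "card S \<le> d" by auto
    have "finite S" using S(1) by (rule finite_subset) simp
    then obtain ys where ys: "set ys = S" "distinct ys"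
      using finite_distinct_list by blast
    let ?xs = "ys @ replicate (d - card S) n"
    have "length ?xs = d" using S(2) ys distinct_card by fastforce
    moreover have "set ?xs \<subseteq> {..n}" "S = set ?xs \<inter> {..<n}"
      using S(1) ys(1) by (auto simp: less_imp_le)
    ultimately show "S \<in> (\<lambda>xs. set xs \<inter> {..<n}) ` {xs. set xs \<subseteq> {..n} \<and> length xs = d}"
      by blast
  qed
  then have "card {S. S \<subseteq> {..<n} \<and> card S \<le> d} \<le> card {xs. set xs \<subseteq> {..n} \<and> length xs = d}"
    by (rule surj_card_le[rotated]) (simp add: finite_lists_length_eq)
  also have "\<dots> = (n + 1) ^ d" by (simp add: card_lists_length_eq)
  finally show ?thesis .
qed

text \<open>The summands bound \<open>H\<close> and \<open>G * (12 * h)\<close>, by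
  \<open>a \<le> n + 1\<close> and \<open>M \<le> (n + 1) ^ d\<close>.\<close>

definition "vertex_bound d q n = 5 * (n + 1) + (n + 1) * ((n + 1) ^ d) ^ q * (12 * (d * q + 3))"
definition "cell_bound d q n = n + (n + 1) ^ d * (d + 2) + d + 3 + vertex_bound d q n
  + (1 + (vertex_bound d q n * vertex_bound d q n + vertex_bound d q n))"

lemma poly_bounded_vertex_bound: "poly_bounded (vertex_bound d q)"
  unfolding vertex_bound_def[abs_def]
  by (intro poly_bounded_add poly_bounded_mult poly_bounded_power poly_bounded_const poly_bounded_id)

lemma poly_bounded_cell_bound: "poly_bounded (cell_bound d q)"
  unfolding cell_bound_def[abs_def]
  by (intro poly_bounded_add poly_bounded_mult poly_bounded_power poly_bounded_const poly_bounded_id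
      poly_bounded_vertex_bound)

context reduction begin

text \<open>The family is listed without repetition, so its length is polynomial in \<open>n\<close>
  alone, as the running time has to be.\<close>

lemma m_le: "m \<le> (n + 1) ^ d"
proof -
  have "m = card F"
    using fam distinct_card[of "map set Fs"] unfolding lists_family_def m_def by simp
  also have "\<dots> \<le> card {S. S \<subseteq> {..<n} \<and> card S \<le> d}"
  proof (rule card_mono)
    show "finite {S. S \<subseteq> {..<n} \<and> card S \<le> d}"
      by (rule finite_subset[of _ "Pow {..<n}"]) auto
    show "F \<subseteq> {S. S \<subseteq> {..<n} \<and> card S \<le> d}" using inst unfolding set_cover_instance_def by blast
  qed
  also have "\<dots> \<le> (n + 1) ^ d" by (rule card_bounded_subsets_le)
  finally show ?thesis .
qed

text \<open>\<open>3 * a\<close> contributes \<open>3 * (n div q) + 3\<close>, the remainder modulo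
  3 at most 2.\<close>

lemma H_le: "H \<le> n + 3 * (n div q) + 5"
proof -
  have "2 * n mod 3 \<le> 2" using mod_less_divisor[of 3 "2 * n"] by linarith
  then show ?thesis unfolding H_def unfolding y_def unfolding a_def by simp
qed

lemma N_le: "N \<le> vertex_bound d q n"
proof -
  have "M \<le> (n + 1) ^ d"
  proof (cases "m = 0")
    case True
    then show ?thesis unfolding M_def using one_le_power[of "n + 1" d] by simp
  next
    case False
    then show ?thesis unfolding M_def using m_le by simp
  qed
  then have "M ^ q \<le> ((n + 1) ^ d) ^ q" by (rule power_mono) simp
  moreover have "a \<le> n + 1" by (simp add: a_def)
  ultimately have "G * (12 * h) \<le> (n + 1) * ((n + 1) ^ d) ^ q * (12 * (d * q + 3))"
    unfolding G_def h_def by (intro mult_le_mono) auto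
  moreover have "n + 3 * x + 5 \<le> 5 * (n + 1)" if "x \<le> n" for x using that by simp
  then have "n + 3 * (n div q) + 5 \<le> 5 * (n + 1)" using div_le_dividend by blast
  then have "H \<le> 5 * (n + 1)" using H_le by (rule order_trans[rotated])
  ultimately show ?thesis unfolding N_def vertex_bound_def by simp
qed

lemma B_le: "B \<le> cell_bound d q n"
  unfolding B_def cell_bound_def L_def
  using N_le m_le by (intro add_mono mult_le_mono) auto

end

text \<open>The constant 5 in \<open>H_le\<close> costs \<open>b ^ 5 \<le> 32\<close>; the other hub
  vertices go into the new base because \<open>3 * (n div q) \<le> (3 / q) * n\<close>. Building the
  graph is polynomial, and \<open>1 \<le> b\<close> lets it be charged to the same
  exponential.\<close>

lemma solves_set_cover_prog:
  fixes b :: real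
  assumes "solves_triangle_partition_hub c (12 * (d * q + 3)) (d * q + 3) b"
    and b: "1 \<le> b" "b \<le> 2" and "1 \<le> d" "1 \<le> q"
  shows "solves_set_cover (set_cover_prog d q c) d (b powr (1 + 3 / real q))"
proof -
  let ?b = "b powr (1 + 3 / real q)"
  obtain k where k: "\<And>N p E Q. simple_graph {..<N} E \<Longrightarrow> is_hub (12 * (d * q + 3)) (d * q + 3) {..<N} E Q \<Longrightarrow>
      card Q \<le> p \<Longrightarrow> decides_within c (encode_graph_hub N E Q) (triangle_partition {..<N} E)
          (b ^ p * real (k * N ^ k + k))"
    using assms(1) unfolding solves_triangle_partition_hub_def by blast
  have "poly_bounded (\<lambda>n. (build_weight d q * (cell_bound d q n + 1)\<^sup>2 + 6) +
      32 * (k * vertex_bound d q n ^ k + k))"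
    by (intro poly_bounded_add poly_bounded_mult poly_bounded_power poly_bounded_const
        poly_bounded_cell_bound poly_bounded_vertex_bound)
  then obtain K where K: "\<And>n. (build_weight d q * (cell_bound d q n + 1)\<^sup>2 + 6) +
      32 * (k * vertex_bound d q n ^ k + k) \<le> K * n ^ K + K"
    using poly_boundedE by blast
  have b1: "1 \<le> ?b" using b by (simp add: ge_one_powr_ge_zero)
  have "decides_within (set_cover_prog d q c) (encode_set_cover n Fs t) (set_cover {..<n} F t)
      (?b ^ n * real (K * n ^ K + K))"
    if "set_cover_instance d {..<n} F" "lists_family Fs F" for n F Fs t
  proof -
    interpret reduction d q n t F Fs using that assms by unfold_locales
    let ?T = "b ^ H * real (k * N ^ k + k)"
    have "decides_within c (encode_graph_hub N E {..<H}) (triangle_partition {..<N} E) ?T"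
      using is_hub_E by (intro k simple_graph_E) (auto simp: h_def)
    then have dec: "decides_within (set_cover_prog d q c) (encode_set_cover n Fs t) (set_cover {..<n} F t)
        (real (build_weight d q * (B + 1)\<^sup>2 + 6) + ?T)"
      by (rule set_cover_prog_decides)
    have bH: "b ^ H \<le> 32 * ?b ^ n"
    proof -
      have "b ^ H \<le> b ^ (n + 3 * (n div q) + 5)" using H_le b by (intro power_increasing) auto
      also have "\<dots> = b ^ (n + 3 * (n div q)) * b ^ 5" by (simp add: power_add)
      also have "\<dots> \<le> ?b ^ n * 32"
      proof (rule mult_mono)
        have "b ^ (n + 3 * (n div q)) = b powr real (n + 3 * (n div q))"
          using b by (simp add: powr_realpow[symmetric])
        also have "\<dots> \<le> b powr ((1 + 3 / real q) * real n)"
        proof (rule powr_mono)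
          have "real (n div q) \<le> real n / real q" by (rule of_nat_div_le_of_nat)
          moreover have "(1 + 3 / real q) * real n = real n + 3 * (real n / real q)"
            by (simp add: algebra_simps)
          ultimately show "real (n + 3 * (n div q)) \<le> (1 + 3 / real q) * real n" by simp
        qed (use b in simp)
        also have "\<dots> = ?b ^ n" using b b1 powr_realpow[of ?b n] by (simp add: powr_powr[symmetric])
        finally show "b ^ (n + 3 * (n div q)) \<le> ?b ^ n" .
        have "b ^ 5 \<le> 2 ^ 5" using b by (intro power_mono) auto
        then show "b ^ 5 \<le> 32" by simp
      qed (use b in auto)
      finally show ?thesis by (simp add: mult.commute)
    qed
    have B2: "build_weight d q * (B + 1)\<^sup>2 + 6 \<le> build_weight d q * (cell_bound d q n + 1)\<^sup>2 + 6"
      using B_le by (intro add_mono mult_le_mono power_mono) auto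
    have N2: "k * N ^ k + k \<le> k * vertex_bound d q n ^ k + k"
      using N_le by (intro add_mono mult_le_mono power_mono) auto
    have bn: "1 \<le> ?b ^ n" using b1 by (rule one_le_power)
    have "real (build_weight d q * (B + 1)\<^sup>2 + 6) + ?T \<le>
        ?b ^ n * real (build_weight d q * (cell_bound d q n + 1)\<^sup>2 + 6) +
        (32 * ?b ^ n) * real (k * vertex_bound d q n ^ k + k)"
    proof (rule add_mono)
      have "real (build_weight d q * (B + 1)\<^sup>2 + 6) \<le> 1 * real (build_weight d q * (cell_bound d q n + 1)\<^sup>2 + 6)"
        using B2 by (simp only: of_nat_le_iff mult_1)
      also have "\<dots> \<le> ?b ^ n * real (build_weight d q * (cell_bound d q n + 1)\<^sup>2 + 6)"
        using bn by (intro mult_right_mono) auto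
      finally show "real (build_weight d q * (B + 1)\<^sup>2 + 6) \<le>
          ?b ^ n * real (build_weight d q * (cell_bound d q n + 1)\<^sup>2 + 6)" .
      show "?T \<le> (32 * ?b ^ n) * real (k * vertex_bound d q n ^ k + k)"
        using bH N2 bn by (intro mult_mono) (auto simp only: of_nat_le_iff of_nat_0_le_iff)
    qed
    also have "\<dots> = ?b ^ n * real ((build_weight d q * (cell_bound d q n + 1)\<^sup>2 + 6) +
        32 * (k * vertex_bound d q n ^ k + k))"
      by (simp add: algebra_simps)
    also have "\<dots> \<le> ?b ^ n * real (K * n ^ K + K)"
      using K[of n] bn by (intro mult_left_mono) (simp_all only: of_nat_le_iff)
    finally show ?thesis using dec unfolding decides_within_def by (meson order_trans)
  qed
  then show ?thesis unfolding solves_set_cover_def by blast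
qed

section \<open>The base of the exponential and the choice of the constants\<close>

lemma exec_pos: "exec c s t s' \<Longrightarrow> 0 < t"
  by (induction rule: exec.induct) (use len_pos in auto)

text \<open>For large \<epsilon> the base \<open>2 - \<epsilon>\<close> is not positive. But running
  times are, and on the empty graph the bound with \<open>p = 1\<close> is a nonnegative multiple of
  the base.\<close>

lemma solves_triangle_partition_hub_pos:
  assumes "solves_triangle_partition_hub c \<sigma> \<delta> b"
  shows "0 < b"
proof -
  obtain k where k: "\<And>n p E Q. simple_graph {..<n} E \<Longrightarrow> is_hub \<sigma> \<delta> {..<n} E Q \<Longrightarrow>
      card Q \<le> p \<Longrightarrow> decides_within c (encode_graph_hub n E Q) (triangle_partition {..<n} E)
          (b ^ p * real (k * n ^ k + k))"
    using assms unfolding solves_triangle_partition_hub_def by blast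
  have "simple_graph {..<0::nat} {}" by (simp add: simple_graph_def sym_def irrefl_def)
  moreover have "is_hub \<sigma> \<delta> {..<0::nat} {} {}" by (simp add: is_hub_def components_on_def)
  ultimately obtain t s s' where "exec c s t s'" "real t \<le> b ^ 1 * real (k * 0 ^ k + k)"
    using k[of 0 "{}" "{}" 1] unfolding decides_within_def by auto
  then have "0 < b * real (k * 0 ^ k + k)" using exec_pos[of c s t s'] by simp
  moreover have "0 \<le> real (k * 0 ^ k + k)" by (rule of_nat_0_le_iff)
  ultimately show ?thesis by (metis not_less zero_less_mult_iff)
qed

lemma solves_triangle_partition_hub_mono:
  assumes "solves_triangle_partition_hub c \<sigma> \<delta> b" "b \<le> b'"
  shows "solves_triangle_partition_hub c \<sigma> \<delta> b'"
proof -
  have "0 < b" using assms(1) by (rule solves_triangle_partition_hub_pos)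
  then have "b ^ p * real K \<le> b' ^ p * real K" for p K
    using assms(2) by (intro mult_right_mono power_mono) auto
  then show ?thesis
    using assms(1) unfolding solves_triangle_partition_hub_def decides_within_def
    by (meson order_trans)
qed

theorem theorem9p3:
  "\<forall>\<epsilon>::real. \<epsilon> > 0 \<longrightarrow>
     (\<exists>\<sigma>\<ge>1. \<exists>\<delta>\<ge>1. SCC \<longrightarrow> \<not> (\<exists>c. solves_triangle_partition_hub c \<sigma> \<delta> (2 - \<epsilon>)))"
proof (intro allI impI)
  fix \<epsilon> :: real assume "\<epsilon> > 0"
  \<comment> \<open>Bases below 1 are raised to 1, since \<open>solves_set_cover_prog\<close> asks
    for \<open>1 \<le> b\<close>.\<close>
  define b where "b = max 1 (2 - \<epsilon>)"
  have b: "1 \<le> b" "b < 2" "2 - \<epsilon> \<le> b" using \<open>\<epsilon> > 0\<close> by (auto simp: b_def)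
  show "\<exists>\<sigma>\<ge>1. \<exists>\<delta>\<ge>1. SCC \<longrightarrow> \<not> (\<exists>c. solves_triangle_partition_hub c \<sigma> \<delta> (2 - \<epsilon>))"
  proof (cases SCC)
    case True
    \<comment> \<open>The exponent tends to 1 and \<open>b < 2\<close>, so a suitable
      \<open>q\<close> exists before \<open>d\<close> is known.\<close>
    have "(\<lambda>q. b powr (1 + 3 / real q)) \<longlonglongrightarrow> b powr (1 + 0)"
      using b(1) by (intro tendsto_intros lim_const_over_n) auto
    then have "\<forall>\<^sub>F q in sequentially. b powr (1 + 3 / real q) < 2"
      by (rule order_tendstoD) (use b in simp)
    then have "\<forall>\<^sub>F q in sequentially. b powr (1 + 3 / real q) < 2 \<and> 1 \<le> q"
      using eventually_ge_at_top by (rule eventually_conj)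
    then obtain q where q: "b powr (1 + 3 / real q) < 2" "1 \<le> q"
      using eventually_happens'[OF sequentially_bot] by blast
    have "\<exists>d\<ge>1. \<not> (\<exists>c. solves_set_cover c d (2 - (2 - b powr (1 + 3 / real q))))"
      using True[unfolded SCC_def, rule_format, of "2 - b powr (1 + 3 / real q)"] q(1) by simp
    then obtain d where d: "1 \<le> d" "\<not> (\<exists>c. solves_set_cover c d (b powr (1 + 3 / real q)))"
      by auto
    have "\<not> (\<exists>c. solves_triangle_partition_hub c (12 * (d * q + 3)) (d * q + 3) (2 - \<epsilon>))"
      using solves_triangle_partition_hub_mono[OF _ b(3)] solves_set_cover_prog b q(2) d
      by (meson less_imp_le)
    then show ?thesis
      by (intro exI[of _ "12 * (d * q + 3)"] exI[of _ "d * q + 3"] conjI impI) auto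
  qed auto
qed

end
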